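(* Let $\rho_0:\mathbb{T}\to(\tfrac12,1]$ be a smooth initial profile. Letting $\ell_N=(\log N)^8$ and $t_N=\ell_N^4/N^2$, we have $$\lim_{N\to\infty}\mathbb{P}_{\mu_N}\big(\eta_{t_N}\notin\mathcal{E}_N\big)=0.$$
   Context: $\mathbb{T}=[0,1)$ is the one-dimensional continuous torus and $\mathbb{T}_N=\mathbb{Z}/N\mathbb{Z}=\{1,\dots,N\}$ is the discrete torus. Configurations are $\eta\in\{0,1\}^{\mathbb{T}_N}$. The facilitated exclusion process has generator $$\mathcal{L}_Nf(\eta)=\sum_{x\in\mathbb{T}_N}c_{x,x+1}(\eta)\big(f(\eta^{x,x+1})-f(\eta)\big),$$ $$c_{x,x+1}(\eta)=\eta(x-1)\eta(x)(1-\eta(x+1))+\eta(x+2)\eta(x+1)(1-\eta(x)),$$ where $\eta^{x,y}$ is obtained from $\eta$ by exchanging the values at $x$ and $y$. The initial measure is the product measure $$\mu_N(\eta)=\prod_{k\in\mathbb{T}_N}\Big(\rho_0(\tfrac kN)\eta(k)+\big(1-\rho_0(\tfrac kN)\big)(1-\eta(k))\Big).$$ $\{\eta_t: t\ge0\}$ is the Markov process with accelerated generator $N^2\mathcal{L}_N$ and initial law $\mu_N$, and $\mathbb{P}_{\mu_N}$ is its law. The set of ergodic configurations is $$\mathcal{E}_N=\Big\{\eta\in\{0,1\}^{\mathbb{T}_N}:\ \forall x\in\mathbb{T}_N,\ (\eta(x),\eta(x+1))\ne(0,0)\ \text{ and }\ \sum_{x\in\mathbb{T}_N}\eta(x)>\tfrac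 N2\Big\}.$$ *)

theory Defs
  imports "HOL-Probability.Probability" "HOL-Number_Theory.Cong"
begin

section \<open>Functions on the continuous torus\<close>

text \<open>
  A function on the torus \<open>[0,1) = \<real>/\<int>\<close> is a 1-periodic function on the real line.
\<close>

definition smooth_on_torus :: "(real \<Rightarrow> real) \<Rightarrow> bool" where
  "smooth_on_torus \<rho> \<longleftrightarrow>
     (\<forall>u. \<rho> (u + 1) = \<rho> u) \<and> (\<forall>k u. (deriv ^^ k) \<rho> differentiable (at u))"


section \<open>Markov processes on a finite state space\<close>

text \<open>
  The semigroup \<open>e\<^bsup>tL\<^esup>\<close> of a generator \<open>L\<close>, as its exponential series applied to an observable.
\<close>

definition semigroup_of ::
  "(('s \<Rightarrow> real) \<Rightarrow> 's \<Rightarrow> real) \<Rightarrow> real \<Rightarrow> ('s \<Rightarrow> real) \<Rightarrow> 's \<Rightarrow> real" where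
  "semigroup_of L t f s = (\<Sum>k. t ^ k / fact k * (L ^^ k) f s)"

definition transition_prob ::
  "(('s \<Rightarrow> real) \<Rightarrow> 's \<Rightarrow> real) \<Rightarrow> real \<Rightarrow> 's \<Rightarrow> 's \<Rightarrow> real" where
  "transition_prob L t s s' = semigroup_of L t (indicator {s'}) s"

text \<open>
  \<open>X\<close>, defined on the probability space \<open>M\<close>, is a Markov process on the finite set \<open>S\<close> with
  generator \<open>L\<close> and initial law \<open>\<mu>\<close>: its paths are right-continuous with left limits for the
  discrete topology on \<open>S\<close>, and its finite-dimensional distributions are the Markovian ones.
  The case \<open>n = 0\<close> of the last clause says that \<open>X 0\<close> has law \<open>\<mu>\<close>.
\<close>

definition markov_process ::
  "'s set \<Rightarrow> (('s \<Rightarrow> real) \<Rightarrow> 's \<Rightarrow> real) \<Rightarrow> ('s \<Rightarrow> real) \<Rightarrow> 'w measure \<Rightarrow> (real \<Rightarrow> 'w \<Rightarrow> 's) \<Rightarrow> bool"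
where
  "markov_process S L \<mu> M X \<longleftrightarrow>
     prob_space M \<and>
     (\<forall>t\<ge>0. X t \<in> measurable M (count_space S)) \<and>
     (\<forall>\<omega>\<in>space M. \<forall>t\<ge>0. eventually (\<lambda>u. X u \<omega> = X t \<omega>) (at_right t)) \<and>
     (\<forall>\<omega>\<in>space M. \<forall>t>0. \<exists>s\<in>S. eventually (\<lambda>u. X u \<omega> = s) (at_left t)) \<and>
     (\<forall>n (t :: nat \<Rightarrow> real) s.
        t 0 = 0 \<longrightarrow> (\<forall>i<n. t i \<le> t (Suc i)) \<longrightarrow> (\<forall>i\<le>n. s i \<in> S) \<longrightarrow>
        measure M {\<omega> \<in> space M. \<forall>i\<le>n. X (t i) \<omega> = s i} =
          \<mu> (s 0) * (\<Prod>i<n. transition_prob L (t (Suc i) - t i) (s i) (s (Suc i))))"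


section \<open>The facilitated exclusion process on the discrete torus\<close>

text \<open>
  A configuration on \<open>\<int>/N\<int>\<close> is an \<open>N\<close>-periodic function on \<open>\<int>\<close>; sums and products over the
  discrete torus run over the representatives \<open>1, \<dots>, N\<close>.
\<close>

definition configs :: "nat \<Rightarrow> (int \<Rightarrow> nat) set" where
  "configs N = {\<eta>. (\<forall>x. \<eta> x \<in> {0, 1}) \<and> (\<forall>x. \<eta> (x + int N) = \<eta> x)}"

definition exchange :: "nat \<Rightarrow> (int \<Rightarrow> nat) \<Rightarrow> int \<Rightarrow> int \<Rightarrow> (int \<Rightarrow> nat)" where
  "exchange N \<eta> x y =
     (\<lambda>z. if [z = x] (mod int N) then \<eta> y
          else if [z = y] (mod int N) then \<eta> x
          else \<eta> z)"

definition jump_rate :: "(int \<Rightarrow> nat) \<Rightarrow> int \<Rightarrow> real" where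
  "jump_rate \<eta> x =
     real (\<eta> (x - 1)) * real (\<eta> x) * (1 - real (\<eta> (x + 1))) +
     real (\<eta> (x + 2)) * real (\<eta> (x + 1)) * (1 - real (\<eta> x))"

definition fep_generator ::
  "nat \<Rightarrow> ((int \<Rightarrow> nat) \<Rightarrow> real) \<Rightarrow> (int \<Rightarrow> nat) \<Rightarrow> real" where
  "fep_generator N f \<eta> =
     (\<Sum>x\<in>{1..int N}. jump_rate \<eta> x * (f (exchange N \<eta> x (x + 1)) - f \<eta>))"

definition accelerated_generator ::
  "nat \<Rightarrow> ((int \<Rightarrow> nat) \<Rightarrow> real) \<Rightarrow> (int \<Rightarrow> nat) \<Rightarrow> real" where
  "accelerated_generator N f \<eta> = (real N)\<^sup>2 * fep_generator N f \<eta>"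

definition initial_law :: "(real \<Rightarrow> real) \<Rightarrow> nat \<Rightarrow> (int \<Rightarrow> nat) \<Rightarrow> real" where
  "initial_law \<rho> N \<eta> =
     (\<Prod>k\<in>{1..int N}. \<rho> (real_of_int k / real N) * real (\<eta> k) +
                       (1 - \<rho> (real_of_int k / real N)) * (1 - real (\<eta> k)))"

definition ergodic_configs :: "nat \<Rightarrow> (int \<Rightarrow> nat) set" where
  "ergodic_configs N =
     {\<eta> \<in> configs N. (\<forall>x\<in>{1..int N}. (\<eta> x, \<eta> (x + 1)) \<noteq> (0, 0)) \<and>
                     real (\<Sum>x\<in>{1..int N}. \<eta> x) > real N / 2}"

definition ell :: "nat \<Rightarrow> real" where
  "ell N = (ln (real N)) ^ 8"

definition t_scale :: "nat \<Rightarrow> real" where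
  "t_scale N = (ell N) ^ 4 / (real N)\<^sup>2"

end

theory Submission
  imports Defs "HOL-Real_Asymp.Real_Asymp"
begin

text \<open>
  Call a pair of adjacent empty sites \<open>x, x + 1\<close> a trap. Traps are never created, and a trap does not
  move until it is filled. For a nonnegative decreasing convex weight \<open>l\<close> supported on \<open>m\<close> sites, put
  \<open>G \<eta> = exp (\<Sum>\<^sub>i l i (1 - 2 \<eta> (x + i)))\<close>. While the trap at \<open>x\<close> persists, \<open>G\<close> is a supermartingale:
  the block of particles ending at a hole gains less by jumping right than it loses by jumping left.
  If \<open>G < 1\<close>, two adjacent particles lie in the window, and then \<open>G\<close> decays at a rate of order
  \<open>1 / m\<^sup>2\<close>. Since \<open>G\<close> is bounded below by \<open>1 / K\<close> with \<open>ln K\<close> of order \<open>m\<close>, the trap survives up to a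
  time \<open>t \<gg> m\<^sup>3\<close> only if \<open>G\<close> reaches \<open>1\<close> before, which has probability at most the initial mean of \<open>G\<close>;
  this mean is exponentially small in \<open>m\<close> because \<open>\<rho>\<^sub>0\<close> is bounded away from \<open>1/2\<close>. With \<open>m\<close> of order
  \<open>(ln N)\<^sup>2\<close> a union bound over \<open>x\<close> concludes. The mass constraint is the same bound with a constant
  weight, for which \<open>G\<close> is conserved.
\<close>

section \<open>Uniformization of a finite jump process\<close>

locale bounded_jump_process =
  fixes S :: "'s set" and X :: "'x set"
    and r :: "'s \<Rightarrow> 'x \<Rightarrow> real" and j :: "'s \<Rightarrow> 'x \<Rightarrow> 's" and q :: real
  assumes finite_S: "finite S"
    and rate_nonneg: "\<And>s x. s \<in> S \<Longrightarrow> x \<in> X \<Longrightarrow> 0 \<le> r s x"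
    and total_rate_le: "\<And>s. s \<in> S \<Longrightarrow> (\<Sum>x\<in>X. r s x) \<le> q"
    and jump_closed: "\<And>s x. s \<in> S \<Longrightarrow> x \<in> X \<Longrightarrow> j s x \<in> S"
    and q_pos: "0 < q"
begin

definition gen :: "('s \<Rightarrow> real) \<Rightarrow> 's \<Rightarrow> real" where
  "gen f s = (\<Sum>x\<in>X. r s x * (f (j s x) - f s))"

text \<open>Divided by \<open>q\<close>, this is the transition kernel of the uniformized
  discrete-time chain. Unlike \<open>gen\<close> it preserves order on \<open>S\<close>, because its
  jump coefficients and its holding coefficient \<open>q - (\<Sum>x\<in>X. r s x)\<close> are
  nonnegative; the semigroup series can thus be compared term by term.\<close>

definition shifted_gen :: "('s \<Rightarrow> real) \<Rightarrow> 's \<Rightarrow> real" where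
  "shifted_gen f s = gen f s + q * f s"

lemma gen_sum: "gen (\<lambda>s. \<Sum>i\<in>I. c i * f i s) s = (\<Sum>i\<in>I. c i * gen (f i) s)"
proof -
  have "gen (\<lambda>s. \<Sum>i\<in>I. c i * f i s) s = (\<Sum>x\<in>X. \<Sum>i\<in>I. c i * (r s x * (f i (j s x) - f i s)))"
    unfolding gen_def
    by (intro sum.cong refl)
      (simp add: sum_subtractf[symmetric] sum_distrib_left algebra_simps)
  also have "\<dots> = (\<Sum>i\<in>I. c i * gen (f i) s)"
    unfolding gen_def by (subst sum.swap) (simp add: sum_distrib_left)
  finally show ?thesis .
qed

lemma gen_iter_sum: "(gen ^^ k) (\<lambda>s. \<Sum>i\<in>I. f i s) = (\<lambda>s. \<Sum>i\<in>I. (gen ^^ k) (f i) s)"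
proof (induction k)
  case (Suc k)
  then show ?case by (intro ext) (simp add: gen_sum[where c="\<lambda>_. 1", simplified])
qed simp

lemma shifted_gen_eq:
  "shifted_gen f s = (\<Sum>x\<in>X. r s x * f (j s x)) + (q - (\<Sum>x\<in>X. r s x)) * f s"
  unfolding shifted_gen_def gen_def
  by (simp add: algebra_simps sum_subtractf sum_distrib_left)

lemma shifted_gen_mono:
  assumes "\<And>s. s \<in> S \<Longrightarrow> f s \<le> g s" "s \<in> S"
  shows "shifted_gen f s \<le> shifted_gen g s"
  unfolding shifted_gen_eq using assms rate_nonneg total_rate_le jump_closed
  by (intro add_mono sum_mono mult_left_mono) auto

lemma shifted_gen_scale: "shifted_gen (\<lambda>s. c * f s) s = c * shifted_gen f s"
  unfolding shifted_gen_eq by (simp add: algebra_simps sum_distrib_left)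

text \<open>Constants are eigenfunctions of \<open>shifted_gen\<close> with eigenvalue
  \<open>q\<close>, so comparison with \<open>c\<close> and \<open>- c\<close> propagates through
  the iterates.\<close>

lemma abs_shifted_gen_iter_le:
  assumes "\<And>s. s \<in> S \<Longrightarrow> \<bar>f s\<bar> \<le> c" "s \<in> S"
  shows "\<bar>(shifted_gen ^^ k) f s\<bar> \<le> q ^ k * c"
  using assms(2)
proof (induction k arbitrary: s)
  case 0
  then show ?case using assms(1) by simp
next
  case (Suc k)
  let ?g = "(shifted_gen ^^ k) f"
  have one: "shifted_gen (\<lambda>_. a) s = q * a" for a
    by (simp add: shifted_gen_def gen_def)
  have "shifted_gen ?g s \<le> shifted_gen (\<lambda>_. q ^ k * c) s"
       "shifted_gen (\<lambda>_. - (q ^ k * c)) s \<le> shifted_gen ?g s"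
    using Suc by (intro shifted_gen_mono; force simp: abs_le_iff)+
  then show ?case unfolding one by (simp add: abs_le_iff)
qed

text \<open>Binomial theorem for \<open>gen = shifted_gen - q\<close>, as scalars commute with the
  operator.\<close>

lemma gen_iter_binomial:
  "(gen ^^ k) f s = (\<Sum>i\<le>k. real (k choose i) * (-q) ^ (k - i) * (shifted_gen ^^ i) f s)"
proof (induction k arbitrary: s)
  case (Suc k)
  let ?A = "\<lambda>i. (shifted_gen ^^ i) f s"
  have "(gen ^^ Suc k) f s
      = gen (\<lambda>s. \<Sum>i\<le>k. real (k choose i) * (-q) ^ (k - i) * (shifted_gen ^^ i) f s) s"
    using Suc by (simp flip: Suc add: fun_eq_iff)
  also have "\<dots> = (\<Sum>i\<le>k. real (k choose i) * (-q) ^ (k - i) * (?A (Suc i) - q * ?A i))"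
    unfolding gen_sum by (simp add: shifted_gen_def)
  also have "\<dots> = (\<Sum>i\<le>k. real (k choose i) * (-q) ^ (k - i) * ?A (Suc i))
                 + (\<Sum>i\<le>k. real (k choose i) * (-q) ^ (Suc k - i) * ?A i)"
    by (subst sum.distrib[symmetric], rule sum.cong) (simp_all add: Suc_diff_le algebra_simps)
  also have "(\<Sum>i\<le>k. real (k choose i) * (-q) ^ (Suc k - i) * ?A i)
           = (-q) ^ Suc k * ?A 0 + (\<Sum>i\<le>k. real (k choose Suc i) * (-q) ^ (k - i) * ?A (Suc i))"
  proof -
    \<comment> \<open>The added summand has the coefficient \<open>k choose Suc k = 0\<close>;
      splitting off index 0 then prepares Pascal's rule.\<close>
    have "(\<Sum>i\<le>k. real (k choose i) * (-q) ^ (Suc k - i) * ?A i)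
        = (\<Sum>i\<le>Suc k. real (k choose i) * (-q) ^ (Suc k - i) * ?A i)"
      by simp
    also have "\<dots> = (-q) ^ Suc k * ?A 0 + (\<Sum>i\<le>k. real (k choose Suc i) * (-q) ^ (k - i) * ?A (Suc i))"
      by (subst sum.atMost_Suc_shift) simp
    finally show ?thesis .
  qed
  also have "(\<Sum>i\<le>k. real (k choose i) * (-q) ^ (k - i) * ?A (Suc i)) + \<dots>
           = (-q) ^ Suc k * ?A 0 + (\<Sum>i\<le>k. real (Suc k choose Suc i) * (-q) ^ (k - i) * ?A (Suc i))"
    by (simp add: sum.distrib[symmetric] algebra_simps)
  also have "\<dots> = (\<Sum>i\<le>Suc k. real (Suc k choose i) * (-q) ^ (Suc k - i) * ?A i)"
    by (subst sum.atMost_Suc_shift) simp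
  finally show ?case .
qed simp

text \<open>The exponential series of \<open>gen\<close> is the Cauchy product of the absolutely
  convergent series of \<open>exp (- q * t)\<close> and of \<open>shifted_gen\<close>.\<close>

lemma uniformization:
  assumes s: "s \<in> S"
  shows "summable (\<lambda>k. t ^ k / fact k * (gen ^^ k) f s)"
    and "summable (\<lambda>k. t ^ k / fact k * (shifted_gen ^^ k) f s)"
    and "semigroup_of gen t f s = exp (- q * t) * (\<Sum>k. t ^ k / fact k * (shifted_gen ^^ k) f s)"
proof -
  define c where "c = (\<Sum>s\<in>S. \<bar>f s\<bar>)"
  have c: "\<bar>f s\<bar> \<le> c" if "s \<in> S" for s
    unfolding c_def using finite_S that by (intro member_le_sum) auto
  define A where "A = (\<lambda>k. t ^ k / fact k * (shifted_gen ^^ k) f s)"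
  define E where "E = (\<lambda>k. (- q * t) ^ k / fact k)"
  have E: "summable (\<lambda>k. norm (E k))"
    unfolding E_def using summable_norm_exp[of "- q * t"] by (simp add: divide_inverse mult.commute)
  have A: "summable (\<lambda>k. norm (A k))"
  proof (rule summable_comparison_test')
    show "summable (\<lambda>k. (q * \<bar>t\<bar>) ^ k / fact k * c)"
      using summable_exp_generic[of "q * \<bar>t\<bar>"] by (intro summable_mult2) (simp add: divide_inverse mult.commute)
    fix k
    have "norm (A k) = \<bar>t\<bar> ^ k / fact k * \<bar>(shifted_gen ^^ k) f s\<bar>"
      by (simp add: A_def abs_mult power_abs)
    also have "\<dots> \<le> \<bar>t\<bar> ^ k / fact k * (q ^ k * c)"
      by (intro mult_left_mono abs_shifted_gen_iter_le c s) auto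
    finally show "norm (norm (A k)) \<le> (q * \<bar>t\<bar>) ^ k / fact k * c"
      by (simp add: power_mult_distrib mult_ac)
  qed
  have conv: "t ^ k / fact k * (gen ^^ k) f s = (\<Sum>i\<le>k. A i * E (k - i))" for k
    unfolding gen_iter_binomial sum_distrib_left
  proof (intro sum.cong refl)
    fix i assume i: "i \<in> {..k}"
    then have "t ^ k = t ^ i * t ^ (k - i)" by (simp flip: power_add)
    moreover have "(- q * t) ^ (k - i) = (- q) ^ (k - i) * t ^ (k - i)"
      by (rule power_mult_distrib)
    ultimately show "t ^ k / fact k * (real (k choose i) * (- q) ^ (k - i) * (shifted_gen ^^ i) f s) =
        A i * E (k - i)"
      using i by (simp add: A_def E_def binomial_fact)
  qed
  show "summable (\<lambda>k. t ^ k / fact k * (gen ^^ k) f s)"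
    unfolding conv using A E by (rule summable_Cauchy_product)
  show "summable (\<lambda>k. t ^ k / fact k * (shifted_gen ^^ k) f s)"
    using A unfolding A_def by (rule summable_norm_cancel)
  have "(\<Sum>k. E k) = exp (- q * t)"
    by (simp add: E_def exp_def divide_inverse mult.commute)
  then show "semigroup_of gen t f s = exp (- q * t) * (\<Sum>k. t ^ k / fact k * (shifted_gen ^^ k) f s)"
    unfolding semigroup_of_def conv using Cauchy_product[OF A E] by (simp add: A_def mult.commute)
qed

lemma semigroup_of_sum:
  assumes "s \<in> S"
  shows "semigroup_of gen t (\<lambda>s. \<Sum>i\<in>I. f i s) s = (\<Sum>i\<in>I. semigroup_of gen t (f i) s)"
  unfolding semigroup_of_def gen_iter_sum sum_distrib_left
  by (intro suminf_sum uniformization assms)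

lemma semigroup_of_mono:
  assumes fg: "\<And>s. s \<in> S \<Longrightarrow> f s \<le> g s" and s: "s \<in> S" and t: "0 \<le> t"
  shows "semigroup_of gen t f s \<le> semigroup_of gen t g s"
proof -
  have "(shifted_gen ^^ k) f s \<le> (shifted_gen ^^ k) g s" if "s \<in> S" for k s
    using that by (induction k arbitrary: s) (auto intro!: fg shifted_gen_mono)
  then show ?thesis
    unfolding uniformization(3)[OF s]
    by (intro mult_left_mono suminf_le uniformization(2) s) (auto simp: s t)
qed

text \<open>
  Truncating at \<open>1\<close> lets the supersolution \<open>(1 + K e\<^bsup>-et\<^esup>) G\<close> absorb the states with \<open>G \<ge> 1\<close>,
  where \<open>G\<close> need not decay.
\<close>

lemma semigroup_of_indicator_le:
  assumes G_pos: "\<And>s. s \<in> S \<Longrightarrow> 0 < G s"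
    and no_entry: "\<And>s x. s \<in> S - A \<Longrightarrow> x \<in> X \<Longrightarrow> r s x \<noteq> 0 \<Longrightarrow> j s x \<notin> A"
    and decay: "\<And>s. s \<in> S \<inter> A \<Longrightarrow> G s < 1 \<Longrightarrow> gen (\<lambda>s. indicator A s * G s) s \<le> - e * G s"
    and K: "\<And>s. s \<in> S \<inter> A \<Longrightarrow> 1 \<le> (1 + K) * G s" "0 \<le> K"
    and e: "0 \<le> e" "e \<le> q" and t: "0 \<le> t" and s: "s \<in> S"
  shows "semigroup_of gen t (indicator A) s \<le> (1 + K * exp (- e * t)) * G s"
proof -
  \<comment> \<open>One uniformized step contracts by \<theta>, and averaging
    \<open>\<theta> ^ k\<close> over a Poisson variable of mean \<open>q * t\<close> gives
    \<open>exp (- e * t)\<close>.\<close>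
  define \<theta> where "\<theta> = 1 - e / q"
  have \<theta>: "0 \<le> \<theta>" "\<theta> \<le> 1" and q\<theta>: "q * \<theta> = q - e"
    using e q_pos by (auto simp: \<theta>_def field_simps)
  define c where "c k = 1 + K * \<theta> ^ k" for k
  have c_ge1: "1 \<le> c k" for k using \<theta> K(2) by (simp add: c_def)
  define w where "w k s = indicator A s * min 1 (c k * G s)" for k s
  have step: "shifted_gen (w k) s \<le> q * w (Suc k) s" if s: "s \<in> S" for k s
  proof -
    consider "s \<notin> A" | "s \<in> A" "1 \<le> c (Suc k) * G s" | "s \<in> A" "c (Suc k) * G s < 1" by linarith
    then show ?thesis
    proof cases
      case 1
      have "(\<Sum>x\<in>X. r s x * w k (j s x)) = 0"
        using no_entry s 1 by (intro sum.neutral) (force simp: w_def)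
      then show ?thesis
        using 1 by (simp add: shifted_gen_eq w_def[of _ s])
    next
      case 2
      have "shifted_gen (w k) s \<le> shifted_gen (\<lambda>_. 1) s"
        by (rule shifted_gen_mono[OF _ s]) (auto simp: w_def indicator_def)
      then show ?thesis
        using 2 by (simp add: w_def shifted_gen_def gen_def)
    next
      case 3
      \<comment> \<open>Staying below the cap at \<open>Suc k\<close> forces \<open>G s < 1\<close>,
        the region where \<open>decay\<close> is available.\<close>
      have "G s \<le> c (Suc k) * G s" using c_ge1[of "Suc k"] G_pos[OF s] by simp
      then have "G s < 1" using 3 by linarith
      have "w k s \<le> c k * (indicator A s * G s)" for s
        by (auto simp: w_def indicator_def)
      then have "shifted_gen (w k) s \<le> shifted_gen (\<lambda>s. c k * (indicator A s * G s)) s"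
        by (intro shifted_gen_mono s)
      also have "\<dots> = c k * (gen (\<lambda>s. indicator A s * G s) s + q * G s)"
        unfolding shifted_gen_scale using 3 by (simp add: shifted_gen_def)
      also have "\<dots> \<le> c k * (q * \<theta> * G s)"
        unfolding q\<theta> using c_ge1[of k] decay[of s] 3 s \<open>G s < 1\<close>
        by (intro mult_left_mono) (auto simp: algebra_simps)
      also have "\<dots> = q * G s * (\<theta> + K * \<theta> ^ Suc k)"
        by (simp add: c_def algebra_simps)
      \<comment> \<open>Only the part of \<open>c k\<close> that carries \<open>K\<close> has to
        contract; the constant part gives its factor \<theta> away.\<close>
      also have "\<dots> \<le> q * G s * (1 + K * \<theta> ^ Suc k)"
        using q_pos G_pos[OF s] \<theta> by (intro mult_left_mono) auto
      also have "\<dots> = q * w (Suc k) s"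
        using 3 by (simp add: w_def c_def)
      finally show ?thesis .
    qed
  qed
  \<comment> \<open>At \<open>k = 0\<close> the assumption on \<open>K\<close> makes the truncated
    function equal to 1 on \<open>A\<close>.\<close>
  have iter: "(shifted_gen ^^ k) (indicator A) s \<le> q ^ k * w k s" if "s \<in> S" for k s
    using that
  proof (induction k arbitrary: s)
    case 0
    then show ?case using K(1)[of s] by (cases "s \<in> A") (auto simp: w_def c_def)
  next
    case (Suc k)
    have "(shifted_gen ^^ Suc k) (indicator A) s \<le> shifted_gen (\<lambda>s. q ^ k * w k s) s"
      using Suc by (auto intro!: shifted_gen_mono)
    also have "\<dots> \<le> q ^ k * (q * w (Suc k) s)"
      unfolding shifted_gen_scale using step[OF Suc.prems] q_pos by (intro mult_left_mono) auto
    finally show ?case by (simp add: mult_ac)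
  qed
  have "(\<lambda>k. (q * t) ^ k /\<^sub>R fact k) sums exp (q * t)"
       "(\<lambda>k. ((q - e) * t) ^ k /\<^sub>R fact k) sums exp ((q - e) * t)"
    by (rule exp_converges)+
  then have "(\<lambda>k. ((q * t) ^ k /\<^sub>R fact k + K * (((q - e) * t) ^ k /\<^sub>R fact k)) * G s)
      sums ((exp (q * t) + K * exp ((q - e) * t)) * G s)"
    by (intro sums_mult2 sums_add sums_mult)
  moreover have "((q * t) ^ k /\<^sub>R fact k + K * (((q - e) * t) ^ k /\<^sub>R fact k)) * G s
      = t ^ k / fact k * (q ^ k * (c k * G s))" for k
    unfolding q\<theta>[symmetric] c_def by (simp add: power_mult_distrib field_simps)
  ultimately have sums: "(\<lambda>k. t ^ k / fact k * (q ^ k * (c k * G s)))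
      sums ((exp (q * t) + K * exp ((q - e) * t)) * G s)" by simp
  have "t ^ k / fact k * (shifted_gen ^^ k) (indicator A) s \<le> t ^ k / fact k * (q ^ k * (c k * G s))" for k
  proof (intro mult_left_mono)
    have "w k s \<le> c k * G s"
      using c_ge1[of k] G_pos[OF s] by (auto simp: w_def indicator_def)
    then show "(shifted_gen ^^ k) (indicator A) s \<le> q ^ k * (c k * G s)"
      using iter[OF s, of k] zero_le_power[of q k] q_pos mult_left_mono[of "w k s" "c k * G s" "q ^ k"] by linarith
  qed (use t in auto)
  then have "(\<Sum>k. t ^ k / fact k * (shifted_gen ^^ k) (indicator A) s)
      \<le> (exp (q * t) + K * exp ((q - e) * t)) * G s"
    using suminf_le[OF _ uniformization(2)[OF s] sums_summable[OF sums]] sums_unique[OF sums] by simp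
  then have "semigroup_of gen t (indicator A) s
      \<le> exp (- q * t) * ((exp (q * t) + K * exp ((q - e) * t)) * G s)"
    unfolding uniformization(3)[OF s] by (intro mult_left_mono) auto
  also have "\<dots> = (exp (- q * t) * exp (q * t) + K * (exp (- q * t) * exp ((q - e) * t))) * G s"
    by (simp add: algebra_simps)
  also have "\<dots> = (1 + K * exp (- e * t)) * G s"
    by (simp flip: exp_add add: algebra_simps)
  finally show ?thesis .
qed

end


section \<open>Configurations on the discrete torus\<close>

lemma config_cong:
  assumes "\<eta> \<in> configs N" "[x = y] (mod int N)"
  shows "\<eta> x = \<eta> y"
proof -
  have per: "\<eta> (z + int N) = \<eta> z" for z
    using assms(1) by (simp add: configs_def)
  have nat: "\<eta> (z + int N * int k) = \<eta> z" for z k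
  proof (induction k)
    case (Suc k)
    then show ?case using per[of "z + int N * int k"] by (simp add: algebra_simps)
  qed simp
  obtain k where k: "y = x + int N * k"
    using assms(2) by (metis cong_iff_lin)
  show ?thesis
  proof (cases "0 \<le> k")
    case True
    then show ?thesis using nat[of x "nat k"] k by simp
  next
    case False
    then show ?thesis using nat[of y "nat (- k)"] k by simp
  qed
qed

lemma config_values: "\<eta> \<in> configs N \<Longrightarrow> \<eta> x = 0 \<or> \<eta> x = 1"
  by (auto simp: configs_def)

lemma exchange_in_configs:
  assumes "\<eta> \<in> configs N"
  shows "exchange N \<eta> x y \<in> configs N"
proof -
  have [simp]: "[z + int N = x] (mod int N) \<longleftrightarrow> [z = x] (mod int N)" for z x
    by (simp add: cong_def)
  show ?thesis
    using assms by (auto simp: configs_def exchange_def)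
qed

text \<open>Moving the window by one site trades \<open>F y\<close> for the equal value
  \<open>F (y + int N)\<close>. Sums over the torus can therefore start at the trap.\<close>

lemma sum_periodic:
  fixes F :: "int \<Rightarrow> 'a :: comm_monoid_add"
  assumes "\<And>z. F (z + int N) = F z"
  shows "(\<Sum>z\<in>{1..int N}. F z) = (\<Sum>i<N. F (x + int i))"
proof -
  have shift: "(\<Sum>i<N. F (y + 1 + int i)) = (\<Sum>i<N. F (y + int i))" for y
  proof (cases N)
    case (Suc n)
    have "(\<Sum>i<N. F (y + 1 + int i)) = (\<Sum>i<n. F (y + int (Suc i))) + F (y + int N)"
      by (simp add: Suc algebra_simps)
    also have "\<dots> = (\<Sum>i<N. F (y + int i))"
      using assms[of y] sum.lessThan_Suc_shift[of "\<lambda>i. F (y + int i)" n]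
      unfolding Suc by (simp add: add.commute)
    finally show ?thesis .
  qed simp
  have "(\<Sum>i<N. F (1 + int i)) = (\<Sum>i<N. F (x + int i))"
  proof (induction x rule: int_induct[where k = 1])
    case (step1 i)
    then show ?case using shift[of i] by simp
  next
    case (step2 i)
    then show ?case using shift[of "i - 1"] by simp
  qed simp
  moreover have "(\<Sum>z\<in>{1..int N}. F z) = (\<Sum>i<N. F (1 + int i))"
    by (rule sum.reindex_bij_witness[of _ "\<lambda>i. 1 + int i" "\<lambda>z. nat (z - 1)"]) auto
  ultimately show ?thesis by simp
qed

text \<open>A periodic configuration is determined by one period. This gives finiteness and lets
  sums of products over \<open>configs N\<close> factor over sites.\<close>

lemma bij_configs:
  assumes "N \<ge> 1"
  shows "bij_betw (\<lambda>\<eta>. restrict \<eta> {1..int N}) (configs N) (PiE {1..int N} (\<lambda>_. {0, 1}))"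
proof -
  \<comment> \<open>The shift by one selects the representative in \<open>1, ..., N\<close> instead
    of \<open>0, ..., N - 1\<close>.\<close>
  define rep where "rep z = (z - 1) mod int N + 1" for z
  have rep: "rep z \<in> {1..int N}" "[rep z = z] (mod int N)" "rep (z + int N) = rep z" for z
  proof -
    show "rep z \<in> {1..int N}"
    proof -
      have "0 < int N" using assms by simp
      then have "0 \<le> (z - 1) mod int N" "(z - 1) mod int N < int N"
        by (rule pos_mod_sign, rule pos_mod_bound)
      then show ?thesis unfolding rep_def atLeastAtMost_iff by linarith
    qed
    show "[rep z = z] (mod int N)"
      by (simp add: rep_def cong_def mod_simps)
    have "z + int N - 1 = z - 1 + int N" by simp
    then show "rep (z + int N) = rep z"
      by (simp only: rep_def mod_add_self2)
  qed
  have rep_id: "rep z = z" if "z \<in> {1..int N}" for z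
    using that by (simp add: rep_def)
  show ?thesis
  proof (rule bij_betw_byWitness[where f' = "\<lambda>g z. g (rep z)"])
    show "\<forall>\<eta>\<in>configs N. (\<lambda>z. restrict \<eta> {1..int N} (rep z)) = \<eta>"
    proof (intro ballI ext)
      fix \<eta> z assume "\<eta> \<in> configs N"
      then show "restrict \<eta> {1..int N} (rep z) = \<eta> z"
        using rep(1,2)[of z] config_cong by (simp only: restrict_apply if_True)
    qed
    show "\<forall>g\<in>PiE {1..int N} (\<lambda>_. {0, 1}). restrict (\<lambda>z. g (rep z)) {1..int N} = g"
      by (auto simp: rep_id PiE_def extensional_def fun_eq_iff)
    show "(\<lambda>\<eta>. restrict \<eta> {1..int N}) ` configs N \<subseteq> PiE {1..int N} (\<lambda>_. {0, 1})"
      by (auto simp: configs_def) (metis not_gr_zero One_nat_def)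
    show "(\<lambda>g z. g (rep z)) ` PiE {1..int N} (\<lambda>_. {0, 1}) \<subseteq> configs N"
      using rep(1) by (auto simp: configs_def rep(3) PiE_def Pi_def)
  qed
qed

lemma finite_configs: "N \<ge> 1 \<Longrightarrow> finite (configs N)"
  using bij_betw_finite[OF bij_configs] finite_PiE[of "{1..int N}" "\<lambda>_. {0, 1::nat}"] by blast

lemma sum_prod_configs:
  fixes F :: "int \<Rightarrow> nat \<Rightarrow> 'a :: comm_semiring_1"
  assumes "N \<ge> 1"
  shows "(\<Sum>\<eta>\<in>configs N. \<Prod>k\<in>{1..int N}. F k (\<eta> k)) = (\<Prod>k\<in>{1..int N}. F k 0 + F k 1)"
proof -
  have "(\<Sum>\<eta>\<in>configs N. \<Prod>k\<in>{1..int N}. F k (\<eta> k))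
      = (\<Sum>\<eta>\<in>configs N. \<Prod>k\<in>{1..int N}. F k (restrict \<eta> {1..int N} k))"
    by (intro sum.cong prod.cong) auto
  also have "\<dots> = (\<Sum>g\<in>PiE {1..int N} (\<lambda>_. {0, 1}). \<Prod>k\<in>{1..int N}. F k (g k))"
    by (rule sum.reindex_bij_betw[OF bij_configs[OF assms]])
  also have "\<dots> = (\<Prod>k\<in>{1..int N}. \<Sum>v\<in>{0, 1}. F k v)"
    by (subst prod_sum_PiE) auto
  finally show ?thesis by simp
qed

section \<open>Weighted hole counts and their exponential moments\<close>

definition hole_weight :: "nat \<Rightarrow> (nat \<Rightarrow> real) \<Rightarrow> int \<Rightarrow> (int \<Rightarrow> nat) \<Rightarrow> real" where
  "hole_weight N l x \<eta> = (\<Sum>i<N. l i * (1 - 2 * real (\<eta> (x + int i))))"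

text \<open>Only the offsets \<open>y\<close> and \<open>Suc y\<close> are affected. Requiring
  \<open>Suc y < N\<close> keeps the bond off the seam, where offset \<open>N - 1\<close> is
  followed by offset 0. A particle moving from \<open>y\<close> to \<open>Suc y\<close> raises the
  weight by twice the drop of \<open>l\<close>.\<close>

lemma hole_weight_exchange:
  assumes "Suc y < N"
  shows "hole_weight N l x (exchange N \<eta> (x + int y) (x + int y + 1)) =
    hole_weight N l x \<eta> + 2 * (l y - l (Suc y)) * (real (\<eta> (x + int y)) - real (\<eta> (x + int y + 1)))"
proof -
  let ?\<zeta> = "exchange N \<eta> (x + int y) (x + int y + 1)"
  have cong: "[x + int i = x + int k] (mod int N) \<longleftrightarrow> i = k" if "i < N" "k < N" for i k
    using that by (simp add: cong_add_lcancel cong_int_iff cong_less_modulus_unique_nat)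
      (auto simp: cong_def)
  have val: "?\<zeta> (x + int i) = (if i = y then \<eta> (x + int y + 1)
      else if i = Suc y then \<eta> (x + int y) else \<eta> (x + int i))" if "i < N" for i
    using cong[of i y] cong[of i "Suc y"] that assms by (simp add: exchange_def algebra_simps)
  have "hole_weight N l x ?\<zeta> - hole_weight N l x \<eta>
      = (\<Sum>i<N. 2 * l i * (real (\<eta> (x + int i)) - real (?\<zeta> (x + int i))))"
    unfolding hole_weight_def sum_subtractf[symmetric] by (simp add: algebra_simps)
  also have "\<dots> = (\<Sum>i\<in>{y, Suc y}. 2 * l i * (real (\<eta> (x + int i)) - real (?\<zeta> (x + int i))))"
    using assms by (intro sum.mono_neutral_right) (auto simp: val)
  also have "\<dots> = 2 * l y * (real (\<eta> (x + int y)) - real (?\<zeta> (x + int y)))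
      + 2 * l (Suc y) * (real (\<eta> (x + int (Suc y))) - real (?\<zeta> (x + int (Suc y))))"
    by (subst sum.insert) auto
  also have "?\<zeta> (x + int y) = \<eta> (x + int y + 1)"
    using val[of y] assms by simp
  also have "?\<zeta> (x + int (Suc y)) = \<eta> (x + int y)"
    using val[of "Suc y"] assms by simp
  also have "2 * l y * (real (\<eta> (x + int y)) - real (\<eta> (x + int y + 1)))
      + 2 * l (Suc y) * (real (\<eta> (x + int (Suc y))) - real (\<eta> (x + int y)))
      = 2 * (l y - l (Suc y)) * (real (\<eta> (x + int y)) - real (\<eta> (x + int y + 1)))"
    by (simp add: algebra_simps)
  finally show ?thesis by simp
qed

text \<open>To second order the left side is at most \<open>1 - (2 * p - 1) * l + l^2\<close>; the
  drift is at least \<open>2 * d * l\<close>, and the error \<open>l^2\<close> costs at most half of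
  that because \<open>l \<le> d\<close>.\<close>

lemma bernoulli_mgf_le:
  fixes p d l :: real
  assumes "0 \<le> l" "l \<le> d" "d \<le> 1/2" "1/2 + d \<le> p" "p \<le> 1"
  shows "(1 - p) * exp l + p * exp (- l) \<le> exp (- d * l)"
proof -
  \<comment> \<open>The product equals \<open>1 + l^3\<close>.\<close>
  have "1 \<le> (1 + l) * (1 - l + l\<^sup>2)"
    using assms(1) by (simp add: algebra_simps power2_eq_square)
  then have "inverse (1 + l) \<le> 1 - l + l\<^sup>2"
    using assms(1) by (simp add: field_simps)
  moreover have "exp (- l) \<le> inverse (1 + l)"
    unfolding exp_minus using assms(1) exp_ge_add_one_self[of l] by (intro le_imp_inverse_le) auto
  ultimately have "exp (- l) \<le> 1 - l + l\<^sup>2" by linarith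
  moreover have "exp l \<le> 1 + l + l\<^sup>2"
    using assms by (intro exp_bound) auto
  ultimately have "(1 - p) * exp l + p * exp (- l) \<le> (1 - p) * (1 + l + l\<^sup>2) + p * (1 - l + l\<^sup>2)"
    using assms by (intro add_mono mult_left_mono) auto
  also have "\<dots> = 1 - (2 * p - 1) * l + l * l"
    by (simp add: algebra_simps power2_eq_square)
  also have "\<dots> \<le> 1 - (2 * d) * l + d * l"
    using assms by (intro add_mono diff_mono mult_right_mono) auto
  also have "\<dots> \<le> exp (- d * l)"
    using exp_ge_add_one_self[of "- d * l"] by simp
  finally show ?thesis .
qed

lemma initial_law_nonneg:
  assumes "\<And>u. 0 \<le> \<rho> u \<and> \<rho> u \<le> 1" "\<eta> \<in> configs N"
  shows "0 \<le> initial_law \<rho> N \<eta>"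
  unfolding initial_law_def
proof (rule prod_nonneg)
  fix k
  show "0 \<le> \<rho> (real_of_int k / real N) * real (\<eta> k) + (1 - \<rho> (real_of_int k / real N)) * (1 - real (\<eta> k))"
    using config_values[OF assms(2), of k] assms(1)[of "real_of_int k / real N"] by auto
qed

text \<open>Under the product measure the mean factors over sites, and each factor is an instance of
  \<open>bernoulli_mgf_le\<close>.\<close>

lemma initial_law_exp_hole_weight:
  assumes N: "N \<ge> 1" and \<rho>: "\<And>u. 1/2 + d \<le> \<rho> u \<and> \<rho> u \<le> 1"
    and l: "\<And>i. 0 \<le> l i \<and> l i \<le> d"
  shows "(\<Sum>\<eta>\<in>configs N. initial_law \<rho> N \<eta> * exp (hole_weight N l x \<eta>)) \<le> exp (- d * (\<Sum>i<N. l i))"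
proof -
  have d: "d \<le> 1/2" using \<rho>[of 0] by linarith
  \<comment> \<open>\<Lambda> indexes the weight by sites instead of offsets from \<open>x\<close>,
    to match the factors of \<open>initial_law\<close>.\<close>
  define \<Lambda> where "\<Lambda> k = l (nat ((k - x) mod int N))" for k
  have \<Lambda>_per: "\<Lambda> (k + int N) = \<Lambda> k" for k
  proof -
    have "k + int N - x = k - x + int N" by simp
    then show ?thesis by (simp only: \<Lambda>_def mod_add_self2)
  qed
  have \<Lambda>_shift: "\<Lambda> (x + int i) = l i" if "i < N" for i
    using that by (simp add: \<Lambda>_def)
  have hw: "hole_weight N l x \<eta> = (\<Sum>k\<in>{1..int N}. \<Lambda> k * (1 - 2 * real (\<eta> k)))"
    if "\<eta> \<in> configs N" for \<eta>
  proof (subst sum_periodic[where x = x])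
    show "\<Lambda> (z + int N) * (1 - 2 * real (\<eta> (z + int N))) = \<Lambda> z * (1 - 2 * real (\<eta> z))" for z
      using that by (simp add: \<Lambda>_per configs_def)
  qed (simp add: hole_weight_def \<Lambda>_shift)
  have sum_\<Lambda>: "(\<Sum>k\<in>{1..int N}. \<Lambda> k) = (\<Sum>i<N. l i)"
    by (subst sum_periodic[where x = x]) (simp_all add: \<Lambda>_per \<Lambda>_shift)
  define F where "F k v = (\<rho> (real_of_int k / real N) * real v +
      (1 - \<rho> (real_of_int k / real N)) * (1 - real v)) * exp (\<Lambda> k * (1 - 2 * real v))"
    for k and v :: nat
  have "(\<Sum>\<eta>\<in>configs N. initial_law \<rho> N \<eta> * exp (hole_weight N l x \<eta>))
      = (\<Sum>\<eta>\<in>configs N. \<Prod>k\<in>{1..int N}. F k (\<eta> k))"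
    by (intro sum.cong refl) (simp add: hw exp_sum initial_law_def F_def prod.distrib)
  also have "\<dots> = (\<Prod>k\<in>{1..int N}. F k 0 + F k 1)"
    by (rule sum_prod_configs[OF N])
  also have "\<dots> \<le> (\<Prod>k\<in>{1..int N}. exp (- d * \<Lambda> k))"
  proof (rule prod_mono, intro conjI)
    fix k
    let ?p = "\<rho> (real_of_int k / real N)"
    have F: "F k 0 + F k 1 = (1 - ?p) * exp (\<Lambda> k) + ?p * exp (- \<Lambda> k)"
      by (simp add: F_def)
    have p: "1/2 + d \<le> ?p" "?p \<le> 1" "0 \<le> \<Lambda> k" "\<Lambda> k \<le> d"
      using \<rho> l by (auto simp: \<Lambda>_def)
    show "0 \<le> F k 0 + F k 1" unfolding F using p by (intro add_nonneg_nonneg mult_nonneg_nonneg) auto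
    show "F k 0 + F k 1 \<le> exp (- d * \<Lambda> k)"
      unfolding F using p d by (intro bernoulli_mgf_le) auto
  qed
  also have "\<dots> = exp (- d * (\<Sum>i<N. l i))"
    by (simp only: exp_sum[symmetric] finite_atLeastAtMost_int sum_distrib_left[symmetric] sum_\<Lambda>)
  finally show ?thesis .
qed

text \<open>Here \<open>e i\<close> is the occupation at offset \<open>i\<close> from the trap. A
  block of at least two particles at \<open>p, ..., q\<close> gains \<open>a q\<close> by the jump
  at its right end and loses \<open>b (p - 1)\<close>, at least \<open>a p\<close>, by the jump at
  its left end. The pair sum on the right telescopes along the block to
  \<open>a p - a q\<close>.\<close>

lemma pair_flux_le:
  fixes a b e :: "nat \<Rightarrow> real"
  assumes e: "\<And>i. e i = 0 \<or> e i = 1" "e 0 = 0" "e 1 = 0"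
    and a: "\<And>i. 0 \<le> a i" and b: "\<And>i. 0 \<le> b i" "\<And>i. a (Suc i) \<le> b i"
  shows "(\<Sum>i<n. e i * e (i + 1) * (1 - e (i + 2)) * a (i + 1) - e (i + 3) * e (i + 2) * (1 - e (i + 1)) * b (i + 1))
    \<le> - (\<Sum>i<n. e (i + 1) * e (i + 2) * (a (i + 1) - a (i + 2)))"
proof -
  \<comment> \<open>The stronger bound keeps boundary terms for a block cut off at the end of the
    range; with them the induction step loses only a nonnegative multiple of
    \<open>b n - a (n + 1)\<close>.\<close>
  have "(\<Sum>i<n. e i * e (i + 1) * (1 - e (i + 2)) * a (i + 1) - e (i + 3) * e (i + 2) * (1 - e (i + 1)) * b (i + 1))
      + (\<Sum>i<n. e (i + 1) * e (i + 2) * (a (i + 1) - a (i + 2)))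
      \<le> - a (n + 1) * e n * e (n + 1) - b n * ((1 - e n) * e (n + 1) * e (n + 2))"
  proof (induction n)
    case 0
    then show ?case using e by simp
  next
    case (Suc n)
    have "0 \<le> (b n - a (n + 1)) * ((1 - e n) * e (n + 1) * e (n + 2))"
      using b(2)[of n] e(1)[of n] e(1)[of "n + 1"] e(1)[of "n + 2"] by (intro mult_nonneg_nonneg) auto
    then show ?case using Suc by (simp add: algebra_simps numeral_2_eq_2 numeral_3_eq_3)
  qed
  moreover have "0 \<le> a (n + 1) * e n * e (n + 1)" "0 \<le> b n * ((1 - e n) * e (n + 1) * e (n + 2))"
    using a b(1) e(1)[of n] e(1)[of "n + 1"] e(1)[of "n + 2"] by (intro mult_nonneg_nonneg; auto)+
  ultimately show ?thesis by linarith
qed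

text \<open>Every isolated particle is outweighed by the hole immediately before it.\<close>

lemma sum_isolated_particles_nonneg:
  fixes l e :: "nat \<Rightarrow> real"
  assumes e: "\<And>i. e i = 0 \<or> e i = 1" "e 0 = 0"
    and l: "antimono l" "\<And>i. 0 \<le> l i"
    and isolated: "\<And>i. Suc i < N \<Longrightarrow> e i = 1 \<Longrightarrow> e (Suc i) = 1 \<Longrightarrow> l (Suc i) = 0"
  shows "0 \<le> (\<Sum>i<N. l i * (1 - 2 * e i))"
proof (cases N)
  case (Suc n)
  \<comment> \<open>The unspent weight of a hole at the last site pays for a particle at the next
    one, whose weight is no larger.\<close>
  have "n < N \<Longrightarrow> (if e n = 0 then l n else 0) \<le> (\<Sum>i<Suc n. l i * (1 - 2 * e i))" for n
  proof (induction n)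
    case 0
    then show ?case using e by simp
  next
    case (Suc n)
    then have IH: "(if e n = 0 then l n else 0) \<le> (\<Sum>i<Suc n. l i * (1 - 2 * e i))" by simp
    have "l (Suc n) \<le> l n" using l(1) by (simp add: antimono_def)
    then show ?case
      using IH l(2)[of n] isolated[of n] Suc.prems e(1)[of n] e(1)[of "Suc n"]
      by (subst sum.lessThan_Suc) (auto split: if_splits)
  qed
  from this[of n] show ?thesis using Suc l(2)[of n] by (auto split: if_splits)
qed simp


section \<open>Persistence of a trap\<close>

lemma jump_rate_values:
  assumes "\<eta> \<in> configs N"
  shows "jump_rate \<eta> x = 0 \<or> jump_rate \<eta> x = 1"
  using config_values[OF assms, of "x - 1"] config_values[OF assms, of x]
    config_values[OF assms, of "x + 1"] config_values[OF assms, of "x + 2"]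
  by (auto simp: jump_rate_def)

text \<open>At most \<open>N\<close> bonds are active, each at rate \<open>N^2\<close>; hence the
  bound \<open>N^3\<close>.\<close>

lemma accelerated_process:
  assumes "N \<ge> 1"
  defines "r \<equiv> \<lambda>\<eta> x. (real N)\<^sup>2 * jump_rate \<eta> x" and "j \<equiv> \<lambda>\<eta> x. exchange N \<eta> x (x + 1)"
  shows "bounded_jump_process (configs N) {1..int N} r j (real N ^ 3)"
    and "bounded_jump_process.gen {1..int N} r j = accelerated_generator N"
proof -
  show proc: "bounded_jump_process (configs N) {1..int N} r j (real N ^ 3)"
  proof
    fix \<eta> assume \<eta>: "\<eta> \<in> configs N"
    show "0 \<le> r \<eta> x" for x
      using jump_rate_values[OF \<eta>, of x] by (auto simp: r_def)
    have "(\<Sum>x\<in>{1..int N}. r \<eta> x) \<le> (\<Sum>x\<in>{1..int N}. (real N)\<^sup>2)"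
    proof (rule sum_mono)
      show "r \<eta> x \<le> (real N)\<^sup>2" for x
        using jump_rate_values[OF \<eta>, of x] by (auto simp: r_def)
    qed
    then show "(\<Sum>x\<in>{1..int N}. r \<eta> x) \<le> real N ^ 3"
      by (simp add: power2_eq_square power3_eq_cube)
    show "j \<eta> x \<in> configs N" for x
      using \<eta> by (simp add: j_def exchange_in_configs)
  qed (use assms(1) in \<open>auto simp: finite_configs\<close>)
  show "bounded_jump_process.gen {1..int N} r j = accelerated_generator N"
    unfolding bounded_jump_process.gen_def[OF proc]
    by (intro ext) (simp add: accelerated_generator_def fep_generator_def r_def j_def
        sum_distrib_left mult.assoc)
qed

context
  fixes N :: nat
  assumes N: "N \<ge> 1"
begin

lemmas accelerated_semigroup_sum =
  bounded_jump_process.semigroup_of_sum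
    [OF accelerated_process(1)[OF N], unfolded accelerated_process(2)[OF N]]

lemmas accelerated_semigroup_mono =
  bounded_jump_process.semigroup_of_mono
    [OF accelerated_process(1)[OF N], unfolded accelerated_process(2)[OF N]]

lemmas accelerated_semigroup_indicator_le =
  bounded_jump_process.semigroup_of_indicator_le
    [OF accelerated_process(1)[OF N], unfolded accelerated_process(2)[OF N]]

end

definition trapped :: "int \<Rightarrow> (int \<Rightarrow> nat) set" where
  "trapped x = {\<eta>. \<eta> x = 0 \<and> \<eta> (x + 1) = 0}"

text \<open>A particle jumps only with another particle behind it. The vacated site then has
  particles on both sides, so no new empty pair arises. The cases locate the pair
  \<open>x, x + 1\<close> relative to the jump bond modulo \<open>N\<close>.\<close>

lemma trapped_no_entry:
  assumes \<eta>: "\<eta> \<in> configs N" and "\<eta> \<notin> trapped x" and rate: "jump_rate \<eta> z \<noteq> 0"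
  shows "exchange N \<eta> z (z + 1) \<notin> trapped x"
proof
  assume tr: "exchange N \<eta> z (z + 1) \<in> trapped x"
  note cong = config_cong[OF \<eta>]
  have sh: "\<eta> (y + c) = \<eta> (z + k + c)" if "[y = z + k] (mod int N)" for y k c
    using that by (intro cong) (simp add: cong_add)
  have same: "[x = z] (mod int N) \<Longrightarrow> \<eta> x = \<eta> z" "[x + 1 = z] (mod int N) \<Longrightarrow> \<eta> (x + 1) = \<eta> z"
    "[x + 1 = z + 1] (mod int N) \<Longrightarrow> \<eta> (x + 1) = \<eta> (z + 1)"
    "[x + 1 = z + 1] (mod int N) \<longleftrightarrow> [x = z] (mod int N)"
    by (auto intro: cong simp: cong_add_rcancel)
  consider "[x = z] (mod int N)" | "[x = z + 1] (mod int N)" | "[x + 1 = z] (mod int N)"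
    | "\<not> [x = z] (mod int N)" "\<not> [x = z + 1] (mod int N)" "\<not> [x + 1 = z] (mod int N)" by blast
  then show False
  proof cases
    case 1
    then have "\<eta> x = \<eta> z" "\<eta> (x + 1) = \<eta> (z + 1)"
      using sh[of x 0 0] sh[of x 0 1] by auto
    moreover have "\<eta> (z + 1) = 0" using tr 1 by (simp add: trapped_def exchange_def)
    ultimately show False using tr 1 rate assms(2) same
      by (auto simp: trapped_def exchange_def jump_rate_def split: if_splits)
  next
    case 2
    then have "\<eta> (x + 1) = \<eta> (z + 2)" "\<eta> x = \<eta> (z + 1)"
      using sh[of x 1 0] sh[of x 1 1] by (auto simp: algebra_simps)
    then show False using tr 2 rate assms(2) same
      by (auto simp: trapped_def exchange_def jump_rate_def split: if_splits)
  next
    case 3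
    then have "\<eta> (x + 1) = \<eta> z" "\<eta> x = \<eta> (z - 1)"
      using sh[of "x + 1" 0 0] sh[of "x + 1" 0 "-1"] by (auto simp: algebra_simps)
    then show False using tr 3 rate assms(2) same
      by (auto simp: trapped_def exchange_def jump_rate_def split: if_splits)
  next
    case 4
    then show False using tr same assms(2) by (auto simp: trapped_def exchange_def)
  qed
qed

text \<open>
  As long as the trap at \<open>x\<close> persists, only the jumps inside \<open>x + 1, \<dots>, x + N - 1\<close> matter: a jump
  across the bond to the left of \<open>x\<close> fills the trap, and the bond inside the trap is frozen.
\<close>

lemma trapped_generator_le:
  fixes a l :: "nat \<Rightarrow> real"
  assumes N: "N = Suc (Suc n)" and \<eta>: "\<eta> \<in> configs N" and tr: "\<eta> \<in> trapped x"
    and a: "\<And>i. 0 \<le> a i" "\<And>i. a (Suc i) \<le> a i / (1 + a i)"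
    and l: "\<And>i. l i - l (Suc i) = ln (1 + a i) / 2"
  defines "e \<equiv> \<lambda>i. real (\<eta> (x + int i))"
  shows "fep_generator N (\<lambda>\<zeta>. indicator (trapped x) \<zeta> * exp (hole_weight N l x \<zeta>)) \<eta>
    \<le> - (\<Sum>i<n. e (i + 1) * e (i + 2) * (a (i + 1) - a (i + 2))) * exp (hole_weight N l x \<eta>)"
proof -
  define G where "G = exp (hole_weight N l x \<eta>)"
  define f where "f \<zeta> = indicator (trapped x) \<zeta> * exp (hole_weight N l x \<zeta>)" for \<zeta>
  define F where "F z = jump_rate \<eta> z * (f (exchange N \<eta> z (z + 1)) - f \<eta>)" for z
  have e01: "e i = 0 \<or> e i = 1" for i
    using config_values[OF \<eta>, of "x + int i"] by (auto simp: e_def)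
  have e0: "e 0 = 0" "e 1 = 0" using tr by (auto simp: e_def trapped_def)
  have f\<eta>: "f \<eta> = G" using tr by (simp add: f_def G_def)
  have cong_per: "[y = z + int N + c] (mod int N) \<longleftrightarrow> [y = z + c] (mod int N)" for y z c
  proof -
    have "z + int N + c = z + c + int N" by simp
    then show ?thesis by (simp only: cong_def mod_add_self2)
  qed
  have \<eta>_per: "\<eta> (z + int N + c) = \<eta> (z + c)" for z c
    by (rule config_cong[OF \<eta>], rule cong_sym) (simp only: cong_per cong_refl)
  have F_per: "F (z + int N) = F z" for z
  proof -
    have "exchange N \<eta> (z + int N) (z + int N + 1) = exchange N \<eta> z (z + 1)"
      using cong_per[of _ z 0] cong_per[of _ z 1] \<eta>_per[of z 0] \<eta>_per[of z 1]
      by (simp add: exchange_def fun_eq_iff)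
    moreover have "jump_rate \<eta> (z + int N) = jump_rate \<eta> z"
      using \<eta>_per[of z "-1"] \<eta>_per[of z 0] \<eta>_per[of z 1] \<eta>_per[of z 2]
      by (simp add: jump_rate_def)
    ultimately show ?thesis by (simp add: F_def)
  qed
  have first: "F x = 0"
    using tr by (simp add: F_def jump_rate_def trapped_def)
  have last: "F (x + int (Suc n)) \<le> 0"
  proof -
    let ?z = "x + int (Suc n)"
    have z: "?z + 1 = x + int N + 0" by (simp add: N)
    have "\<eta> (?z + 1) = \<eta> x"
      unfolding z \<eta>_per by simp
    then have z1: "\<eta> (?z + 1) = 0" using tr by (simp add: trapped_def)
    show ?thesis
    proof (cases "\<eta> ?z = 1")
      case True
      have "\<not> [x = ?z] (mod int N)"
      proof
        assume "[x = ?z] (mod int N)"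
        then have "[int (Suc n) = 0] (mod int N)"
          by (metis add.right_neutral cong_add_lcancel cong_sym)
        then show False by (simp add: cong_def N)
      qed
      moreover have "[x = ?z + 1] (mod int N)"
        unfolding z cong_per by simp
      ultimately have "exchange N \<eta> ?z (?z + 1) \<notin> trapped x"
        using True by (simp add: trapped_def exchange_def)
      then have "f (exchange N \<eta> ?z (?z + 1)) = 0" by (simp add: f_def)
      moreover have "0 \<le> jump_rate \<eta> ?z" using jump_rate_values[OF \<eta>, of ?z] by auto
      ultimately show ?thesis
        by (simp add: F_def f\<eta> G_def)
    next
      case False
      then show ?thesis using config_values[OF \<eta>, of ?z] z1
        by (simp add: F_def jump_rate_def)
    qed
  qed
  have inner: "F (x + int (Suc i)) \<le>
      G * (e i * e (i + 1) * (1 - e (i + 2)) * a (i + 1)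
         - e (i + 3) * e (i + 2) * (1 - e (i + 1)) * (a (i + 1) / (1 + a (i + 1))))" if "i < n" for i
  proof -
    let ?z = "x + int (Suc i)"
    define b where "b = a (i + 1)"
    have b: "0 \<le> b" using a by (simp add: b_def)
    have rate: "jump_rate \<eta> ?z = e i * e (i + 1) * (1 - e (i + 2)) + e (i + 3) * e (i + 2) * (1 - e (i + 1))"
      by (simp add: jump_rate_def e_def algebra_simps)
    \<comment> \<open>The only inner jump that destroys the trap is one onto \<open>x + 1\<close>;
      bounding the indicator by 1 covers it.\<close>
    have "f (exchange N \<eta> ?z (?z + 1)) \<le> exp (hole_weight N l x (exchange N \<eta> ?z (?z + 1)))"
      by (simp add: f_def indicator_def)
    \<comment> \<open>Since \<open>2 * (l i - l (Suc i)) = ln (1 + a i)\<close>, a right jump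
      multiplies \<open>G\<close> by \<open>1 + b\<close> and a left jump divides it by
      \<open>1 + b\<close>: the relative changes are \<open>b\<close> and
      \<open>- b / (1 + b)\<close>.\<close>
    also have "\<dots> = G * exp (ln (1 + b) * (e (i + 1) - e (i + 2)))"
      using hole_weight_exchange[of "Suc i" N l x \<eta>] that l[of "Suc i"]
      by (simp add: N G_def e_def b_def algebra_simps flip: exp_add)
    finally have "F ?z \<le> jump_rate \<eta> ?z * (G * exp (ln (1 + b) * (e (i + 1) - e (i + 2))) - G)"
      unfolding F_def f\<eta> using jump_rate_values[OF \<eta>, of ?z] by auto
    also have "\<dots> = G * (e i * e (i + 1) * (1 - e (i + 2)) * b
         - e (i + 3) * e (i + 2) * (1 - e (i + 1)) * (b / (1 + b)))"
      unfolding rate using e01[of i] e01[of "i + 1"] e01[of "i + 2"] e01[of "i + 3"] b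
      by (elim disjE) (simp_all add: exp_minus field_simps)
    finally show ?thesis by (simp add: b_def)
  qed
  have "fep_generator N f \<eta> = (\<Sum>i<N. F (x + int i))"
    unfolding fep_generator_def F_def[symmetric] by (rule sum_periodic[where F = F, OF F_per])
  also have "\<dots> = F x + (\<Sum>i<n. F (x + int (Suc i))) + F (x + int (Suc n))"
    unfolding N by (subst sum.lessThan_Suc, subst sum.lessThan_Suc_shift) simp
  also have "\<dots> \<le> (\<Sum>i<n. F (x + int (Suc i)))"
    using first last by simp
  also have "\<dots> \<le> (\<Sum>i<n. G * (e i * e (i + 1) * (1 - e (i + 2)) * a (i + 1)
         - e (i + 3) * e (i + 2) * (1 - e (i + 1)) * (a (i + 1) / (1 + a (i + 1)))))"
    by (intro sum_mono inner) simp
  \<comment> \<open>With \<open>b i = a i / (1 + a i)\<close>, the second hypothesis on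
    \<open>a\<close> is the comparison that \<open>pair_flux_le\<close> requires.\<close>
  also have "\<dots> \<le> G * - (\<Sum>i<n. e (i + 1) * e (i + 2) * (a (i + 1) - a (i + 2)))"
    unfolding sum_distrib_left[symmetric]
    by (intro mult_left_mono pair_flux_le[where b = "\<lambda>i. a i / (1 + a i)"])
      (use e01 e0 a in \<open>auto simp: G_def divide_nonneg_nonneg add_nonneg_nonneg\<close>)
  finally show ?thesis by (simp add: f_def[abs_def] G_def mult.commute)
qed

section \<open>The convex weight profile on \<open>m\<close> sites and its decay estimate\<close>

locale trap_profile =
  fixes \<alpha> :: real and m :: nat
  assumes \<alpha>: "0 < \<alpha>" "\<alpha> \<le> 1" and m: "1 \<le> m"
begin

text \<open>
  The jump ratio \<open>1 + a i\<close> is chosen so that \<open>1 / a\<close> grows by at least one at each step, which is the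
  condition \<open>a (i + 1) \<le> a i / (1 + a i)\<close> of the generator bound. Truncated subtraction makes
  \<open>a i = 0\<close> for \<open>i \<ge> m\<close>.
\<close>

definition a :: "nat \<Rightarrow> real" where
  "a i = \<alpha> * real (m - i) / (real m)\<^sup>2"

text \<open>The solution of \<open>2 * (l i - l (Suc i)) = ln (1 + a i)\<close> that vanishes from
  \<open>m\<close> on.\<close>

definition l :: "nat \<Rightarrow> real" where
  "l i = (\<Sum>k\<in>{i..<m}. ln (1 + a k)) / 2"

lemma a_nonneg: "0 \<le> a i"
  using \<alpha> by (simp add: a_def)

lemma a_le_1: "a i \<le> 1"
proof -
  have "\<alpha> * real (m - i) \<le> 1 * real m"
    using \<alpha> by (intro mult_mono) auto
  also have "\<dots> \<le> (real m)\<^sup>2"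
    using m by (simp add: power2_eq_square)
  finally show ?thesis using m by (simp add: a_def)
qed

lemma a_diff: "Suc i \<le> m \<Longrightarrow> a i - a (Suc i) = \<alpha> / (real m)\<^sup>2"
  by (simp add: a_def of_nat_diff algebra_simps flip: diff_divide_distrib)

text \<open>Cleared of its denominator, the claim reads
  \<open>a (Suc i) * a i \<le> a i - a (Suc i)\<close>. For \<open>Suc i \<le> m\<close> the right
  side is the slope \<open>\<alpha> / m^2\<close>, and the left side is that slope times a factor at
  most 1.\<close>

lemma a_Suc_le: "a (Suc i) \<le> a i / (1 + a i)"
proof (cases "Suc i \<le> m")
  case True
  have "\<alpha> * (real (m - Suc i) * real (m - i)) \<le> 1 * (real m * real m)"
    using \<alpha> by (intro mult_mono) auto
  then have "\<alpha> * (real (m - Suc i) * real (m - i)) / (real m)\<^sup>2 \<le> 1"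
    using m by (simp add: power2_eq_square)
  then have "\<alpha> * (real (m - Suc i) * real (m - i)) / (real m)\<^sup>2 * (\<alpha> / (real m)\<^sup>2) \<le> 1 * (\<alpha> / (real m)\<^sup>2)"
    using \<alpha> by (intro mult_right_mono) auto
  then have "a (Suc i) * a i \<le> \<alpha> / (real m)\<^sup>2"
    by (simp add: a_def mult_ac)
  then have "a (Suc i) * (1 + a i) \<le> a i"
    using a_diff[OF True] by (simp add: algebra_simps)
  then show ?thesis using a_nonneg[of i] by (simp add: pos_le_divide_eq)
next
  case False
  then show ?thesis by (simp add: a_def)
qed

lemma l_diff: "l i - l (Suc i) = ln (1 + a i) / 2"
proof (cases "i < m")
  case True
  then show ?thesis by (simp add: l_def sum.atLeast_Suc_lessThan add_divide_distrib)
qed (simp add: l_def a_def)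

lemma l_nonneg: "0 \<le> l i"
  using a_nonneg by (auto simp: l_def intro!: sum_nonneg)

lemma l_eq_0: "m \<le> i \<Longrightarrow> l i = 0"
  by (simp add: l_def)

lemma antimono_l: "antimono l"
proof (unfold antimono_iff_le_Suc, intro allI)
  fix i
  have "0 \<le> ln (1 + a i)" using a_nonneg[of i] by simp
  then show "l (Suc i) \<le> l i" using l_diff[of i] by linarith
qed

lemma l_le: "l i \<le> \<alpha> / 2"
proof -
  have "(\<Sum>k\<in>{i..<m}. ln (1 + a k)) \<le> (\<Sum>k\<in>{i..<m}. \<alpha> / real m)"
  proof (rule sum_mono)
    fix k
    have "ln (1 + a k) \<le> a k" using a_nonneg by (intro ln_add_one_self_le_self)
    also have "\<dots> \<le> \<alpha> * real m / (real m)\<^sup>2"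
      unfolding a_def using \<alpha> by (intro divide_right_mono mult_left_mono) auto
    finally show "ln (1 + a k) \<le> \<alpha> / real m"
      using m by (simp add: power2_eq_square)
  qed
  also have "\<dots> \<le> \<alpha>"
    using m \<alpha> by (simp add: field_simps)
  finally show ?thesis by (simp add: l_def)
qed

text \<open>From \<open>a i \<le> 1\<close> follows \<open>ln (1 + a i) \<ge> a i / 2\<close>, so
  \<open>l\<close> drops by at least \<open>a i / 4\<close> at each step and dominates a discrete
  parabola.\<close>

lemma l_ge: "\<alpha> * (real (m - i))\<^sup>2 / (8 * (real m)\<^sup>2) \<le> l i"
proof (induction "m - i" arbitrary: i)
  case 0
  then show ?case by (simp add: l_nonneg)
next
  case (Suc u)
  then have u: "m - Suc i = u" "m - i = Suc u" by simp_all
  have "a i / 2 \<le> ln (1 + a i)"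
  proof -
    have "a i / 2 \<le> a i / (1 + a i)"
      using a_nonneg[of i] a_le_1[of i] by (intro divide_left_mono) auto
    also have "\<dots> \<le> ln (1 + a i)"
    proof -
      have "ln (inverse (1 + a i)) \<le> inverse (1 + a i) - 1"
        using a_nonneg[of i] by (intro ln_le_minus_one) (auto simp: add_pos_nonneg)
      then have "1 - inverse (1 + a i) \<le> ln (1 + a i)"
        using a_nonneg[of i] by (simp add: ln_inverse)
      moreover have "1 - inverse (1 + a i) = a i / (1 + a i)"
        using a_nonneg[of i] by (simp add: field_simps)
      ultimately show ?thesis by simp
    qed
    finally show ?thesis .
  qed
  then have "l (Suc i) + a i / 4 \<le> l i" using l_diff[of i] by linarith
  moreover have "\<alpha> * (real u)\<^sup>2 / (8 * (real m)\<^sup>2) \<le> l (Suc i)"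
    using Suc.hyps(1)[of "Suc i"] u by simp
  \<comment> \<open>Up to a common factor this is
    \<open>(u + 1)^2 \<le> u^2 + 2 * (u + 1)\<close>.\<close>
  moreover have "\<alpha> * (real (Suc u))\<^sup>2 / (8 * (real m)\<^sup>2) \<le> \<alpha> * (real u)\<^sup>2 / (8 * (real m)\<^sup>2) + a i / 4"
  proof -
    have "\<alpha> * (real u)\<^sup>2 / (8 * (real m)\<^sup>2) + a i / 4
        = \<alpha> * ((real u)\<^sup>2 + 2 * real (Suc u)) / (8 * (real m)\<^sup>2)"
      using m by (simp add: a_def u field_simps)
    also have "\<dots> \<ge> \<alpha> * (real (Suc u))\<^sup>2 / (8 * (real m)\<^sup>2)"
      using \<alpha> by (intro divide_right_mono mult_left_mono) (auto simp: power2_eq_square algebra_simps)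
    finally show ?thesis .
  qed
  ultimately show ?case unfolding u by linarith
qed

text \<open>The upper bound limits how small \<open>exp (hole_weight N l x \<eta>)\<close> can get;
  the lower one makes its initial mean exponentially small in \<open>m\<close>.\<close>

lemma sum_l:
  assumes "m \<le> N"
  shows "(\<Sum>i<N. l i) \<le> real m * \<alpha> / 2" "\<alpha> * real m / 24 \<le> (\<Sum>i<N. l i)"
proof -
  have eq: "(\<Sum>i<N. l i) = (\<Sum>i<m. l i)"
    using assms by (intro sum.mono_neutral_right) (auto simp: l_eq_0)
  show "(\<Sum>i<N. l i) \<le> real m * \<alpha> / 2"
    unfolding eq using sum_bounded_above[of "{..<m}" l "\<alpha> / 2"] l_le by simp
  \<comment> \<open>The 24 is the 8 of \<open>l_ge\<close> times this 3.\<close>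
  have cubes: "real n ^ 3 / 3 \<le> (\<Sum>i<n. (real (Suc i))\<^sup>2)" for n
    by (induction n) (auto simp: power2_eq_square power3_eq_cube algebra_simps)
  have "\<alpha> * real m / 24 = \<alpha> / (8 * (real m)\<^sup>2) * (real m ^ 3 / 3)"
    using m by (simp add: power2_eq_square power3_eq_cube)
  also have "\<dots> \<le> \<alpha> / (8 * (real m)\<^sup>2) * (\<Sum>i<m. (real (Suc i))\<^sup>2)"
    using \<alpha> cubes by (intro mult_left_mono) auto
  also have "(\<Sum>i<m. (real (Suc i))\<^sup>2) = (\<Sum>i<m. (real (m - i))\<^sup>2)"
    by (subst sum.nat_diff_reindex[symmetric]) (auto intro!: sum.cong simp: Suc_diff_Suc)
  also have "\<alpha> / (8 * (real m)\<^sup>2) * \<dots> \<le> (\<Sum>i<m. l i)"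
    unfolding sum_distrib_left using l_ge by (intro sum_mono) (simp del: of_nat_diff)
  finally show "\<alpha> * real m / 24 \<le> (\<Sum>i<N. l i)" unfolding eq .
qed

text \<open>In the truncated supersolution bound, \<open>K\<close> comes from the weight of a full
  window, estimated by \<open>sum_l\<close>, and the rate is the slope of \<open>a\<close>
  accelerated by \<open>N^2\<close>.\<close>

lemma trapped_semigroup_le:
  assumes N: "2 \<le> N" "m \<le> N" and \<eta>: "\<eta> \<in> configs N" and t: "0 \<le> t"
  shows "semigroup_of (accelerated_generator N) t (indicator (trapped x)) \<eta>
    \<le> (1 + exp (real m * \<alpha> / 2) * exp (- (\<alpha> * (real N)\<^sup>2 / (real m)\<^sup>2) * t)) * exp (hole_weight N l x \<eta>)"
proof (rule accelerated_semigroup_indicator_le[where G = "\<lambda>\<zeta>. exp (hole_weight N l x \<zeta>)"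
      and K = "exp (real m * \<alpha> / 2)" and e = "\<alpha> * (real N)\<^sup>2 / (real m)\<^sup>2"])
  define n where "n = N - 2"
  have n: "N = Suc (Suc n)" using N(1) by (simp add: n_def)
  show "1 \<le> N" using N by simp
  show "0 < exp (hole_weight N l x \<zeta>)" for \<zeta> by simp
  show "exchange N \<zeta> z (z + 1) \<notin> trapped x"
    if "\<zeta> \<in> configs N - trapped x" "(real N)\<^sup>2 * jump_rate \<zeta> z \<noteq> 0" for \<zeta> z
    using that by (intro trapped_no_entry) auto
  show "accelerated_generator N (\<lambda>\<zeta>. indicator (trapped x) \<zeta> * exp (hole_weight N l x \<zeta>)) \<zeta>
      \<le> - (\<alpha> * (real N)\<^sup>2 / (real m)\<^sup>2) * exp (hole_weight N l x \<zeta>)"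
    if \<zeta>: "\<zeta> \<in> configs N \<inter> trapped x" and lt: "exp (hole_weight N l x \<zeta>) < 1" for \<zeta>
  proof -
    define e where "e i = real (\<zeta> (x + int i))" for i
    have e01: "e i = 0 \<or> e i = 1" for i
      using config_values[of \<zeta> N "x + int i"] \<zeta> by (auto simp: e_def)
    have e0: "e 0 = 0" using \<zeta> by (auto simp: e_def trapped_def)
    \<comment> \<open>Isolated particles cannot make the weight negative, so some adjacent pair lies
      where \<open>l\<close> is positive.\<close>
    have "hole_weight N l x \<zeta> < 0" using lt by simp
    then obtain i where i: "Suc i < N" "e i = 1" "e (Suc i) = 1" "l (Suc i) \<noteq> 0"
      using sum_isolated_particles_nonneg[of e l N] e01 e0 antimono_l l_nonneg
      unfolding hole_weight_def e_def[symmetric] by fastforce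
    \<comment> \<open>The hole at offset 0 pushes the pair to offset at least 1, where the sum over
      \<open>i + 1\<close> sees it.\<close>
    with e0 obtain k where k: "i = Suc k" by (cases i) auto
    have "Suc i < m" using i(4) l_eq_0[of "Suc i"] by linarith
    have "0 \<le> a i - a (Suc i)" for i
      using a_Suc_le[of i] a_nonneg[of i] by (smt (verit) divide_le_eq mult_less_cancel_left2)
    \<comment> \<open>All summands are nonnegative, so one pair suffices; it contributes the slope
      of \<open>a\<close>.\<close>
    then have "a (k + 1) - a (k + 2) \<le> (\<Sum>i<n. e (i + 1) * e (i + 2) * (a (i + 1) - a (i + 2)))"
      using member_le_sum[of k "{..<n}" "\<lambda>i. e (i + 1) * e (i + 2) * (a (i + 1) - a (i + 2))"]
        i k n by (auto simp: e_def)
    moreover have "a (k + 1) - a (k + 2) = \<alpha> / (real m)\<^sup>2"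
      using a_diff[of i] \<open>Suc i < m\<close> k by simp
    ultimately have "- (\<Sum>i<n. e (i + 1) * e (i + 2) * (a (i + 1) - a (i + 2))) * exp (hole_weight N l x \<zeta>)
        \<le> - (\<alpha> / (real m)\<^sup>2) * exp (hole_weight N l x \<zeta>)"
      by (intro mult_right_mono) auto
    moreover have "fep_generator N (\<lambda>\<zeta>. indicator (trapped x) \<zeta> * exp (hole_weight N l x \<zeta>)) \<zeta>
        \<le> - (\<Sum>i<n. e (i + 1) * e (i + 2) * (a (i + 1) - a (i + 2))) * exp (hole_weight N l x \<zeta>)"
      using \<zeta> unfolding e_def by (intro trapped_generator_le n a_nonneg a_Suc_le l_diff) auto
    ultimately have "fep_generator N (\<lambda>\<zeta>. indicator (trapped x) \<zeta> * exp (hole_weight N l x \<zeta>)) \<zeta>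
        \<le> - (\<alpha> / (real m)\<^sup>2) * exp (hole_weight N l x \<zeta>)" by linarith
    then have "(real N)\<^sup>2 * fep_generator N (\<lambda>\<zeta>. indicator (trapped x) \<zeta> * exp (hole_weight N l x \<zeta>)) \<zeta>
        \<le> (real N)\<^sup>2 * (- (\<alpha> / (real m)\<^sup>2) * exp (hole_weight N l x \<zeta>))"
      by (intro mult_left_mono) auto
    then show ?thesis unfolding accelerated_generator_def by (simp add: mult_ac)
  qed
  show "1 \<le> (1 + exp (real m * \<alpha> / 2)) * exp (hole_weight N l x \<zeta>)"
    if "\<zeta> \<in> configs N \<inter> trapped x" for \<zeta>
  proof -
    have "- (\<Sum>i<N. l i) \<le> hole_weight N l x \<zeta>"
      unfolding hole_weight_def sum_negf[symmetric]
    proof (rule sum_mono)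
      fix i
      show "- l i \<le> l i * (1 - 2 * real (\<zeta> (x + int i)))"
        using config_values[of \<zeta> N "x + int i"] that l_nonneg[of i] by auto
    qed
    then have "0 \<le> real m * \<alpha> / 2 + hole_weight N l x \<zeta>"
      using sum_l(1)[OF N(2)] by linarith
    then have "1 \<le> exp (real m * \<alpha> / 2) * exp (hole_weight N l x \<zeta>)"
      by (simp flip: exp_add)
    then show ?thesis by (simp add: distrib_right add_increasing)
  qed
  have "\<alpha> * (real N)\<^sup>2 / (real m)\<^sup>2 \<le> 1 * (real N)\<^sup>2 / 1"
    using \<alpha> m by (intro frac_le mult_right_mono) auto
  also have "\<dots> \<le> (real N)\<^sup>2 * real N" using N by (simp add: mult_le_cancel_left1)
  finally show "\<alpha> * (real N)\<^sup>2 / (real m)\<^sup>2 \<le> real N ^ 3"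
    by (simp add: power2_eq_square power3_eq_cube)
qed (use \<alpha> t \<eta> in auto)

end


section \<open>The transience time\<close>

definition low_mass :: "nat \<Rightarrow> (int \<Rightarrow> nat) set" where
  "low_mass N = {\<eta>. real (\<Sum>x\<in>{1..int N}. \<eta> x) \<le> real N / 2}"

lemma hole_weight_const:
  assumes "\<eta> \<in> configs N"
  shows "hole_weight N (\<lambda>_. d) x \<eta> = d * (real N - 2 * real (\<Sum>z\<in>{1..int N}. \<eta> z))"
proof -
  have "(\<Sum>z\<in>{1..int N}. \<eta> z) = (\<Sum>i<N. \<eta> (x + int i))"
    using assms by (intro sum_periodic) (simp add: configs_def)
  then show ?thesis
    by (simp add: hole_weight_def sum_subtractf flip: sum_distrib_left)
qed

text \<open>A constant weight does not depend on the base point, so the window may start at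
  \<open>z\<close>; the bond then avoids the seam.\<close>

lemma hole_weight_const_exchange:
  assumes "2 \<le> N" "\<eta> \<in> configs N"
  shows "hole_weight N (\<lambda>_. d) x (exchange N \<eta> z (z + 1)) = hole_weight N (\<lambda>_. d) x \<eta>"
proof -
  have "hole_weight N (\<lambda>_. d) z (exchange N \<eta> z (z + 1)) = hole_weight N (\<lambda>_. d) z \<eta>"
    using hole_weight_exchange[of 0 N "\<lambda>_. d" z \<eta>] assms(1) by simp
  then show ?thesis
    using hole_weight_const[OF assms(2)] hole_weight_const[OF exchange_in_configs[OF assms(2)]] by simp
qed

lemma low_mass_iff:
  assumes "\<eta> \<in> configs N"
  shows "\<eta> \<in> low_mass N \<longleftrightarrow> 0 \<le> hole_weight N (\<lambda>_. 1) 0 \<eta>"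
  by (auto simp: low_mass_def hole_weight_const[OF assms])

text \<open>A Chernoff bound that persists in time because the particle number is conserved.\<close>

lemma low_mass_semigroup_le:
  assumes N: "2 \<le> N" and \<eta>: "\<eta> \<in> configs N" and t: "0 \<le> t" and d: "0 \<le> d"
  shows "semigroup_of (accelerated_generator N) t (indicator (low_mass N)) \<eta>
    \<le> exp (hole_weight N (\<lambda>_. d) x \<eta>)"
proof -
  have conserved: "exchange N \<zeta> z (z + 1) \<in> low_mass N \<longleftrightarrow> \<zeta> \<in> low_mass N"
    if "\<zeta> \<in> configs N" for \<zeta> z
    using that by (simp add: low_mass_iff exchange_in_configs hole_weight_const_exchange[OF N])
  have "semigroup_of (accelerated_generator N) t (indicator (low_mass N)) \<eta>
      \<le> (1 + 0 * exp (- 0 * t)) * exp (hole_weight N (\<lambda>_. d) x \<eta>)"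
  \<comment> \<open>Conservation allows \<open>e = 0\<close>, and \<open>K = 0\<close> is possible
    because the weight is at least 1 on \<open>low_mass N\<close>.\<close>
  proof (rule accelerated_semigroup_indicator_le[where G = "\<lambda>\<zeta>. exp (hole_weight N (\<lambda>_. d) x \<zeta>)"
        and K = 0 and e = 0])
    show "accelerated_generator N (\<lambda>\<zeta>. indicator (low_mass N) \<zeta> * exp (hole_weight N (\<lambda>_. d) x \<zeta>)) \<zeta>
        \<le> - 0 * exp (hole_weight N (\<lambda>_. d) x \<zeta>)" if "\<zeta> \<in> configs N \<inter> low_mass N" for \<zeta>
      using that conserved[of \<zeta>] hole_weight_const_exchange[OF N, of \<zeta> d x]
      by (simp add: accelerated_generator_def fep_generator_def)
    show "1 \<le> (1 + 0) * exp (hole_weight N (\<lambda>_. d) x \<zeta>)" if "\<zeta> \<in> configs N \<inter> low_mass N" for \<zeta>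
    proof -
      have "0 \<le> d * (real N - 2 * real (\<Sum>z\<in>{1..int N}. \<zeta> z))"
        using that d by (intro mult_nonneg_nonneg) (auto simp: low_mass_def)
      then show ?thesis using that by (simp add: hole_weight_const)
    qed
  qed (use N \<eta> t conserved in auto)
  then show ?thesis by simp
qed

text \<open>The joint law at the times 0 and \<open>t\<close>, the case \<open>n = 1\<close> of the
  finite-dimensional laws, is summed over starting points and targets.\<close>

lemma markov_process_marginal_le:
  assumes proc: "markov_process S L \<mu> M X" and S: "finite S" and A: "A \<subseteq> S" and t: "0 \<le> t"
  shows "measure M {\<omega> \<in> space M. X t \<omega> \<in> A} \<le> (\<Sum>s\<in>S. \<mu> s * (\<Sum>a\<in>A. transition_prob L t s a))"
proof -
  interpret prob_space M using proc by (simp add: markov_process_def)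
  have meas: "X u \<in> measurable M (count_space S)" if "0 \<le> u" for u
    using proc that by (simp add: markov_process_def)
  define E where "E s a = {\<omega> \<in> space M. X 0 \<omega> = s \<and> X t \<omega> = a}" for s a
  have E_sets: "E s a \<in> sets M" if "s \<in> S" "a \<in> S" for s a
  proof -
    have "E s a = (X 0 -` {s} \<inter> space M) \<inter> (X t -` {a} \<inter> space M)"
      by (auto simp: E_def)
    then show ?thesis
      using measurable_sets[OF meas[of 0], of "{s}"] measurable_sets[OF meas[OF t], of "{a}"] that by auto
  qed
  have prob_E: "measure M (E s a) = \<mu> s * transition_prob L t s a" if "s \<in> S" "a \<in> S" for s a
  proof -
    have fdd: "measure M {\<omega> \<in> space M. \<forall>i\<le>n. X (u i) \<omega> = v i} =
        \<mu> (v 0) * (\<Prod>i<n. transition_prob L (u (Suc i) - u i) (v i) (v (Suc i)))"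
      if "u 0 = 0" "\<forall>i<n. u i \<le> u (Suc i)" "\<forall>i\<le>n. v i \<in> S" for n and u :: "nat \<Rightarrow> real" and v
      using proc that unfolding markov_process_def by blast
    have two: "(\<forall>i\<le>1. P i) \<longleftrightarrow> P 0 \<and> P 1" for P :: "nat \<Rightarrow> bool"
      by (auto simp: le_Suc_eq)
    let ?u = "\<lambda>i::nat. if i = 0 then 0 else t" and ?v = "\<lambda>i::nat. if i = 0 then s else a"
    have "measure M {\<omega> \<in> space M. \<forall>i\<le>1. X (?u i) \<omega> = ?v i} =
        \<mu> (?v 0) * (\<Prod>i<1. transition_prob L (?u (Suc i) - ?u i) (?v i) (?v (Suc i)))"
      by (rule fdd) (use t that in auto)
    then show ?thesis unfolding E_def two by simp
  qed
  have "{\<omega> \<in> space M. X t \<omega> \<in> A} = (\<Union>(s, a)\<in>S \<times> A. E s a)"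
    using measurable_space[OF meas[of 0]] by (auto simp: E_def)
  also have "measure M \<dots> \<le> (\<Sum>(s, a)\<in>S \<times> A. measure M (E s a))"
    using S A E_sets finite_subset[OF A S]
    by (intro order_trans[OF finite_measure_subadditive_finite]) (auto simp: case_prod_unfold)
  also have "\<dots> = (\<Sum>s\<in>S. \<Sum>a\<in>A. \<mu> s * transition_prob L t s a)"
    using A by (subst sum.cartesian_product[symmetric]) (intro sum.cong refl prob_E; auto)
  finally show ?thesis by (simp add: sum_distrib_left)
qed

lemma not_ergodic_subset:
  "configs N - ergodic_configs N \<subseteq> (\<Union>x\<in>{1..int N}. trapped x) \<union> low_mass N"
  by (auto simp: ergodic_configs_def trapped_def low_mass_def not_less)

text \<open>The indicator of the bad set is a finite sum of point indicators and lies below the sum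
  of the indicators of its possible causes; linearity and monotonicity of the semigroup turn this
  into a union bound.\<close>

lemma not_ergodic_semigroup_le:
  assumes N: "1 \<le> N" and \<eta>: "\<eta> \<in> configs N" and t: "0 \<le> t"
  shows "(\<Sum>\<zeta>\<in>configs N - ergodic_configs N. transition_prob (accelerated_generator N) t \<eta> \<zeta>)
    \<le> (\<Sum>x\<in>{1..int N}. semigroup_of (accelerated_generator N) t (indicator (trapped x)) \<eta>)
      + semigroup_of (accelerated_generator N) t (indicator (low_mass N)) \<eta>"
proof -
  let ?P = "semigroup_of (accelerated_generator N) t"
  let ?B = "configs N - ergodic_configs N"
  \<comment> \<open>\<open>None\<close> stands for the mass constraint and \<open>Some x\<close> for
    the trap at \<open>x\<close>, so one finite sum covers both kinds.\<close>
  define h :: "int option \<Rightarrow> (int \<Rightarrow> nat) \<Rightarrow> real" where "h i = (case i of None \<Rightarrow> indicator (low_mass N) | Some x \<Rightarrow> indicator (trapped x))"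
    for i
  define I where "I = insert None (Some ` {1..int N})"
  have "(\<Sum>\<zeta>\<in>?B. transition_prob (accelerated_generator N) t \<eta> \<zeta>) = ?P (\<lambda>\<xi>. \<Sum>\<zeta>\<in>?B. indicator {\<zeta>} \<xi>) \<eta>"
    unfolding transition_prob_def by (rule accelerated_semigroup_sum[OF N \<eta>, symmetric])
  also have "\<dots> \<le> ?P (\<lambda>\<xi>. \<Sum>i\<in>I. h i \<xi>) \<eta>"
  proof (rule accelerated_semigroup_mono[OF N _ \<eta> t])
    fix \<xi> assume \<xi>: "\<xi> \<in> configs N"
    have "(\<Sum>\<zeta>\<in>?B. indicator {\<zeta>} \<xi>) = (indicator ?B \<xi> :: real)"
      using finite_configs[OF N] by (simp add: indicator_def)
    also have "\<dots> \<le> (\<Sum>i\<in>I. h i \<xi>)"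
    proof (cases "\<xi> \<in> ?B")
      case True
      then consider x where "x \<in> {1..int N}" "\<xi> \<in> trapped x" | "\<xi> \<in> low_mass N"
        using not_ergodic_subset[of N] by blast
      then have "\<exists>i\<in>I. h i \<xi> = 1"
      proof cases
        case (1 x)
        then show ?thesis by (intro bexI[of _ "Some x"]) (auto simp: I_def h_def)
      next
        case 2
        then show ?thesis by (intro bexI[of _ None]) (auto simp: I_def h_def)
      qed
      then obtain i where i: "i \<in> I" "h i \<xi> = 1" by blast
      have "(1::real) \<le> (\<Sum>i\<in>I. h i \<xi>)"
        unfolding i(2)[symmetric] by (rule member_le_sum[OF i(1)]) (auto simp: I_def h_def split: option.split)
      then show ?thesis using True by simp
    qed (auto intro!: sum_nonneg simp: h_def split: option.split)
    finally show "(\<Sum>\<zeta>\<in>?B. indicator {\<zeta>} \<xi>)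
      \<le> (\<Sum>i\<in>I. h i \<xi>)" .
  qed
  also have "\<dots> = (\<Sum>i\<in>I. ?P (h i) \<eta>)"
    by (rule accelerated_semigroup_sum[OF N \<eta>])
  also have "\<dots> = (\<Sum>x\<in>{1..int N}. ?P (indicator (trapped x)) \<eta>) + ?P (indicator (low_mass N)) \<eta>"
    unfolding I_def by (subst sum.insert) (auto simp: sum.reindex h_def)
  finally show ?thesis .
qed

text \<open>The semigroup bounds are averaged over the initial law. The same \<open>d\<close> serves
  as density gap and as profile parameter \<alpha>.\<close>

lemma not_ergodic_prob_le:
  assumes proc: "markov_process (configs N) (accelerated_generator N) (initial_law \<rho> N) M X"
    and \<rho>: "\<And>u. 1/2 + d \<le> \<rho> u \<and> \<rho> u \<le> 1" and d: "0 < d"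
    and N: "2 \<le> N" and m1: "1 \<le> m" "m \<le> N" and t: "0 \<le> t"
  shows "measure M {\<omega> \<in> space M. X t \<omega> \<notin> ergodic_configs N}
    \<le> real N * ((1 + exp (real m * d / 2 - d * (real N)\<^sup>2 / (real m)\<^sup>2 * t)) * exp (- (d\<^sup>2 * real m / 24)))
      + exp (- (d\<^sup>2 * real N))"
proof -
  have d1: "d \<le> 1" using \<rho>[of 0] by linarith
  interpret trap_profile d m using d d1 m1 by unfold_locales auto
  have N1: "1 \<le> N" using N by simp
  let ?P = "semigroup_of (accelerated_generator N) t"
  let ?S = "configs N" and ?\<mu> = "initial_law \<rho> N"
  define c where "c = 1 + exp (real m * d / 2 - d * (real N)\<^sup>2 / (real m)\<^sup>2 * t)"
  have c_eq: "c = 1 + exp (real m * d / 2) * exp (- (d * (real N)\<^sup>2 / (real m)\<^sup>2) * t)"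
    unfolding c_def by (simp flip: exp_add)
  have \<mu>: "0 \<le> ?\<mu> \<eta>" if "\<eta> \<in> ?S" for \<eta>
  proof (rule initial_law_nonneg[OF _ that])
    show "0 \<le> \<rho> u \<and> \<rho> u \<le> 1" for u using \<rho>[of u] d by linarith
  qed
  have "{\<omega> \<in> space M. X t \<omega> \<notin> ergodic_configs N} = {\<omega> \<in> space M. X t \<omega> \<in> ?S - ergodic_configs N}"
  proof -
    have "X t \<in> measurable M (count_space ?S)" using proc t by (simp add: markov_process_def)
    from measurable_space[OF this] show ?thesis by auto
  qed
  then have "measure M {\<omega> \<in> space M. X t \<omega> \<notin> ergodic_configs N}
      \<le> (\<Sum>\<eta>\<in>?S. ?\<mu> \<eta> * (\<Sum>\<zeta>\<in>?S - ergodic_configs N. transition_prob (accelerated_generator N) t \<eta> \<zeta>))"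
    using markov_process_marginal_le[OF proc finite_configs[OF N1] _ t, of "?S - ergodic_configs N"] by simp
  also have "\<dots> \<le> (\<Sum>\<eta>\<in>?S. ?\<mu> \<eta> * ((\<Sum>x\<in>{1..int N}. c * exp (hole_weight N l x \<eta>))
      + exp (hole_weight N (\<lambda>_. d) 0 \<eta>)))"
  proof (intro sum_mono mult_left_mono \<mu>)
    fix \<eta> assume \<eta>: "\<eta> \<in> ?S"
    have "?P (indicator (trapped x)) \<eta> \<le> c * exp (hole_weight N l x \<eta>)" for x
      using trapped_semigroup_le[OF N m1(2) \<eta> t, of x] by (simp only: c_eq)
    moreover have "?P (indicator (low_mass N)) \<eta> \<le> exp (hole_weight N (\<lambda>_. d) 0 \<eta>)"
      using d by (intro low_mass_semigroup_le N \<eta> t) simp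
    ultimately show "(\<Sum>\<zeta>\<in>?S - ergodic_configs N. transition_prob (accelerated_generator N) t \<eta> \<zeta>)
        \<le> (\<Sum>x\<in>{1..int N}. c * exp (hole_weight N l x \<eta>)) + exp (hole_weight N (\<lambda>_. d) 0 \<eta>)"
      by (intro order_trans[OF not_ergodic_semigroup_le[OF N1 \<eta> t]] add_mono sum_mono)
  qed
  also have "\<dots> = (\<Sum>x\<in>{1..int N}. c * (\<Sum>\<eta>\<in>?S. ?\<mu> \<eta> * exp (hole_weight N l x \<eta>)))
      + (\<Sum>\<eta>\<in>?S. ?\<mu> \<eta> * exp (hole_weight N (\<lambda>_. d) 0 \<eta>))"
    unfolding distrib_left sum.distrib sum_distrib_left
    by (subst sum.swap) (simp add: mult_ac)
  also have "\<dots> \<le> (\<Sum>x\<in>{1..int N}. c * exp (- (d\<^sup>2 * real m / 24))) + exp (- (d\<^sup>2 * real N))"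
  proof (intro add_mono sum_mono mult_left_mono)
    fix x
    have "0 \<le> l i \<and> l i \<le> d" for i using l_nonneg[of i] l_le[of i] d by linarith
    then have "(\<Sum>\<eta>\<in>?S. ?\<mu> \<eta> * exp (hole_weight N l x \<eta>)) \<le> exp (- d * (\<Sum>i<N. l i))"
      by (rule initial_law_exp_hole_weight[OF N1 \<rho>])
    also have "\<dots> \<le> exp (- (d\<^sup>2 * real m / 24))"
      using mult_left_mono[OF sum_l(2)[OF m1(2)], of d] d by (simp add: power2_eq_square mult_ac)
    finally show "(\<Sum>\<eta>\<in>?S. ?\<mu> \<eta> * exp (hole_weight N l x \<eta>)) \<le> exp (- (d\<^sup>2 * real m / 24))" .
    have "(\<Sum>\<eta>\<in>?S. ?\<mu> \<eta> * exp (hole_weight N (\<lambda>_. d) 0 \<eta>)) \<le> exp (- d * (\<Sum>i<N. d))"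
      using d by (intro initial_law_exp_hole_weight[OF N1 \<rho>]) simp
    then show "(\<Sum>\<eta>\<in>?S. ?\<mu> \<eta> * exp (hole_weight N (\<lambda>_. d) 0 \<eta>)) \<le> exp (- (d\<^sup>2 * real N))"
      by (simp add: power2_eq_square mult_ac)
  qed (simp add: c_def add_nonneg_nonneg)
  finally show ?thesis by (simp add: c_def)
qed

section \<open>Density gap and choice of the window length\<close>

lemma smooth_torus_gap:
  assumes "smooth_on_torus \<rho>" and gt: "\<And>u. b < \<rho> u"
  obtains d where "0 < d" "\<And>u. b + d \<le> \<rho> u"
proof -
  have diff: "\<rho> differentiable (at u)" for u
    using assms(1) by (auto simp: smooth_on_torus_def dest: spec[of _ 0])
  then have "continuous_on {0..1} \<rho>"
    by (intro continuous_at_imp_continuous_on ballI differentiable_imp_continuous_within)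
  \<comment> \<open>Compactness of one period gives a minimizer; periodicity extends its bound to
    the whole line.\<close>
  then obtain v where v: "v \<in> {0..1}" "\<And>u. u \<in> {0..1} \<Longrightarrow> \<rho> v \<le> \<rho> u"
    using continuous_attains_inf[of "{0..1}" \<rho>] by auto
  have per: "\<rho> (u + 1) = \<rho> u" for u using assms(1) by (simp add: smooth_on_torus_def)
  have int: "\<rho> (u + of_int k) = \<rho> u" for u k
  proof (induction k rule: int_induct[where k = 0])
    case (step1 i)
    then show ?case using per[of "u + of_int i"] by (simp add: algebra_simps)
  next
    case (step2 i)
    then show ?case using per[of "u + of_int (i - 1)"] by (simp add: algebra_simps)
  qed simp
  have "\<rho> v \<le> \<rho> u" for u
    using v(2)[of "frac u"] int[of "frac u" "\<lfloor>u\<rfloor>"] frac_ge_0[of u] frac_lt_1[of u]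
    by (simp add: frac_def)
  with gt[of v] show ?thesis by (intro that[of "\<rho> v - b"]) auto
qed

theorem theorem2p4:
  fixes \<rho>\<^sub>0 :: "real \<Rightarrow> real"
    and M :: "nat \<Rightarrow> 'w measure"
    and \<eta> :: "nat \<Rightarrow> real \<Rightarrow> 'w \<Rightarrow> (int \<Rightarrow> nat)"
  assumes "smooth_on_torus \<rho>\<^sub>0"
    and "\<And>u. 1/2 < \<rho>\<^sub>0 u \<and> \<rho>\<^sub>0 u \<le> 1"
    and "\<And>N. N \<ge> 1 \<Longrightarrow>
           markov_process (configs N) (accelerated_generator N) (initial_law \<rho>\<^sub>0 N) (M N) (\<eta> N)"
  shows "(\<lambda>N. measure (M N) {\<omega> \<in> space (M N). \<eta> N (t_scale N) \<omega> \<notin> ergodic_configs N})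
           \<longlonglongrightarrow> 0"
proof -
  obtain d where d: "0 < d" "\<And>u. 1/2 + d \<le> \<rho>\<^sub>0 u"
    using smooth_torus_gap[OF assms(1), of "1/2"] assms(2) by blast
  \<comment> \<open>The factor \<open>N\<close> of the union bound is beaten because
    \<open>(ln N)^2\<close> dominates \<open>ln N\<close>; the 2 bounds the time-dependent
    factor.\<close>
  define g where "g N = real N * (2 * exp (- (d\<^sup>2 * (ln (real N))\<^sup>2 / 24))) + exp (- (d\<^sup>2 * real N))" for N
  have ev: "eventually (\<lambda>N. ((ln (real N))\<^sup>2 + 1) ^ 3 \<le> 2 * ln (real N) ^ 32) sequentially"
    "eventually (\<lambda>N. (ln (real N))\<^sup>2 + 1 \<le> real N) sequentially"
    "eventually (\<lambda>N. 1 \<le> (ln (real N))\<^sup>2) sequentially"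
    by real_asymp+
  have upper: "eventually (\<lambda>N. measure (M N) {\<omega> \<in> space (M N). \<eta> N (t_scale N) \<omega> \<notin> ergodic_configs N} \<le> g N)
      sequentially"
    using ev eventually_ge_at_top[of 2]
  proof eventually_elim
    case (elim N)
    \<comment> \<open>The window must be much longer than \<open>ln N\<close> for the union bound,
      while its cube stays below the accelerated time.\<close>
    define m where "m = nat \<lceil>(ln (real N))\<^sup>2\<rceil>"
    have m: "(ln (real N))\<^sup>2 \<le> real m" "real m \<le> (ln (real N))\<^sup>2 + 1"
      unfolding m_def by (simp_all add: of_nat_ceiling of_int_ceiling_le_add_one)
    have m1: "1 \<le> m" "m \<le> N" using m elim(2,3) by linarith+
    \<comment> \<open>The exponent is \<open>32 = 8 * 4\<close>, from \<open>ell\<close> and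
      \<open>t_scale\<close>.\<close>
    have time: "(real N)\<^sup>2 * t_scale N = ln (real N) ^ 32"
      using elim(4) by (simp add: t_scale_def ell_def flip: power_mult)
    have "real m ^ 3 \<le> 2 * ln (real N) ^ 32"
      by (rule order_trans[OF power_mono[OF m(2)] elim(1)]) simp
    then have "d * real m ^ 3 \<le> d * (2 * ln (real N) ^ 32)"
      using d(1) by (intro mult_left_mono) auto
    \<comment> \<open>By the cubic bound on \<open>m\<close>, the decay up to time
      \<open>t_scale N\<close> at least compensates the constant \<open>K\<close>.\<close>
    then have "real m * d / 2 \<le> d * ln (real N) ^ 32 / (real m)\<^sup>2"
      using m1 by (simp add: field_simps power2_eq_square power3_eq_cube)
    also have "\<dots> = d * (real N)\<^sup>2 / (real m)\<^sup>2 * t_scale N"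
      unfolding time[symmetric] by simp
    finally have c: "1 + exp (real m * d / 2 - d * (real N)\<^sup>2 / (real m)\<^sup>2 * t_scale N) \<le> 2"
      by simp
    have "0 \<le> t_scale N" by (simp add: t_scale_def ell_def)
    then have "measure (M N) {\<omega> \<in> space (M N). \<eta> N (t_scale N) \<omega> \<notin> ergodic_configs N}
      \<le> real N * ((1 + exp (real m * d / 2 - d * (real N)\<^sup>2 / (real m)\<^sup>2 * t_scale N)) * exp (- (d\<^sup>2 * real m / 24)))
      + exp (- (d\<^sup>2 * real N))"
      using elim(4) d assms(2) m1 by (intro not_ergodic_prob_le[OF assms(3)]) auto
    also have "\<dots> \<le> real N * (2 * exp (- (d\<^sup>2 * (ln (real N))\<^sup>2 / 24))) + exp (- (d\<^sup>2 * real N))"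
      using c m(1) by (intro add_mono mult_left_mono mult_mono order_refl) (auto intro!: mult_left_mono)
    finally show ?case unfolding g_def .
  qed
  have g: "g \<longlonglongrightarrow> 0"
  proof -
    have "0 < d\<^sup>2" using d(1) by simp
    then show ?thesis unfolding g_def by real_asymp
  qed
  show ?thesis
    by (rule tendsto_sandwich[OF _ upper tendsto_const g]) simp
qed

end
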